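(* For all integers $n\ge0$ and $m\ge0$, the following hold. $$F_1(n+m+1,a_n)=\tfrac{1815}{5488}(\tfrac35)^n-\tfrac{99}{1372}(\tfrac1{25})^n+\tfrac{55}{16464}(\tfrac1{375})^n+(\tfrac1{15})^m\Bigl\{-\tfrac{121}{5488}(\tfrac35)^n-\tfrac{22}{1029}(\tfrac1{25})^n+\tfrac{185}{49392}(\tfrac1{375})^n\Bigr\},$$ $$F_2(n+m+1,a_n)=\tfrac{121}{196}-\tfrac{825}{5488}(\tfrac35)^n+\tfrac{171}{1372}(\tfrac1{25})^n-\tfrac{55}{5488}(\tfrac1{375})^n-\tfrac{121}{1176}(\tfrac1{15})^n+\tfrac1{294}(\tfrac1{225})^n$$ $$\qquad+(\tfrac1{15})^m\Bigl\{\tfrac{55}{5488}(\tfrac35)^n+\tfrac{38}{1029}(\tfrac1{25})^n-\tfrac{185}{16464}(\tfrac1{375})^n-\tfrac{143}{3528}(\tfrac1{15})^n+\tfrac{11}{2646}(\tfrac1{225})^n\Bigr\},$$ $$F_3(n+m+1,a_n)=\tfrac{33}{98}-\tfrac{855}{5488}(\tfrac35)^n-\tfrac{45}{1372}(\tfrac1{25})^n+\tfrac{55}{5488}(\tfrac1{375})^n+\tfrac{11}{147}(\tfrac1{15})^n-\tfrac1{147}(\tfrac1{225})^n$$ $$\qquad+(\tfrac1{15})^m\Bigl\{\tfrac{57}{5488}(\tfrac35)^n-\tfrac{10}{1029}(\tfrac1{25})^n+\tfrac{185}{16464}(\tfrac1{375})^n+\tfrac{13}{441}(\tfrac1{15})^n-\tfrac{11}{1323}(\tfrac1{225})^n\Bigr\},$$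 $$F_4(n+m+1,a_n)=\tfrac{9}{196}-\tfrac{135}{5488}(\tfrac35)^n-\tfrac{27}{1372}(\tfrac1{25})^n-\tfrac{55}{16464}(\tfrac1{375})^n+\tfrac{11}{392}(\tfrac1{15})^n+\tfrac1{294}(\tfrac1{225})^n$$ $$\qquad+(\tfrac1{15})^m\Bigl\{\tfrac{9}{5488}(\tfrac35)^n-\tfrac{2}{343}(\tfrac1{25})^n-\tfrac{185}{49392}(\tfrac1{375})^n+\tfrac{13}{1176}(\tfrac1{15})^n+\tfrac{11}{2646}(\tfrac1{225})^n\Bigr\},$$ and $$F_1(n+m+1,c_n)=\tfrac{1089}{2744}(\tfrac35)^n-\tfrac{22}{343}(\tfrac1{25})^n+\tfrac{5}{8232}(\tfrac1{375})^n+(\tfrac1{15})^m\Bigl\{-\tfrac{121}{1372}(\tfrac35)^n-\tfrac{121}{4116}(\tfrac1{25})^n+\tfrac{20}{3087}(\tfrac1{375})^n\Bigr\},$$ $$F_2(n+m+1,c_n)=\tfrac{121}{196}-\tfrac{495}{2744}(\tfrac35)^n+\tfrac{38}{343}(\tfrac1{25})^n-\tfrac{5}{2744}(\tfrac1{375})^n-\tfrac{55}{588}(\tfrac1{15})^n$$ $$\qquad+(\tfrac1{15})^m\Bigl\{\tfrac{55}{1372}(\tfrac35)^n+\tfrac{209}{4116}(\tfrac1{25})^n-\tfrac{20}{1029}(\tfrac1{375})^n-\tfrac{22}{441}(\tfrac1{15})^n+\tfrac{10}{1323}(\tfrac1{225})^n\Bigr\},$$ $$F_3(n+m+1,c_n)=\tfrac{33}{98}-\tfrac{513}{2744}(\tfrac35)^n-\tfrac{10}{343}(\tfrac1{25})^n+\tfrac{5}{2744}(\tfrac1{375})^n+\tfrac{10}{147}(\tfrac1{15})^n$$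 $$\qquad+(\tfrac1{15})^m\Bigl\{\tfrac{57}{1372}(\tfrac35)^n-\tfrac{55}{4116}(\tfrac1{25})^n+\tfrac{20}{1029}(\tfrac1{375})^n+\tfrac{16}{441}(\tfrac1{15})^n-\tfrac{20}{1323}(\tfrac1{225})^n\Bigr\},$$ $$F_4(n+m+1,c_n)=\tfrac{9}{196}-\tfrac{81}{2744}(\tfrac35)^n-\tfrac{6}{343}(\tfrac1{25})^n-\tfrac{5}{8232}(\tfrac1{375})^n+\tfrac{5}{196}(\tfrac1{15})^n$$ $$\qquad+(\tfrac1{15})^m\Bigl\{\tfrac{9}{1372}(\tfrac35)^n-\tfrac{11}{1372}(\tfrac1{25})^n-\tfrac{20}{3087}(\tfrac1{375})^n+\tfrac{2}{147}(\tfrac1{15})^n+\tfrac{10}{1323}(\tfrac1{225})^n\Bigr\}.$$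
   Context: The two-dimensional Sierpinski gasket graph $SG(n)$, $n\ge 0$, is drawn in the plane with three outmost vertices: leftmost $o$, rightmost $a_n$, topmost $b_n$. $SG(0)$ is a triangle (3 vertices, 3 edges). $SG(n+1)$ consists of three copies of $SG(n)$ (lower-left, lower-right, top), where the rightmost vertex of the lower-left copy is identified with the leftmost vertex of the lower-right copy, the topmost vertex of the lower-left copy with the leftmost vertex of the top copy, and the topmost vertex of the lower-right copy with the rightmost vertex of the top copy. For $k\le N$, $SG(k)$ is regarded as the sub-copy of $SG(N)$ containing the leftmost vertex $o$ (iterating the lower-left copy), so that $a_k$ and $b_k$ are vertices of every $SG(N)$ with $N\ge k$; $c_k$ denotes the vertex of $SG(k+1)$ shared by its lower-right and top copies of $SG(k)$, also regarded as a vertex of $SG(N)$ for $N\ge k+1$. $f(N)$ is the number of spanning trees of $SG(N)$, $f_j(N,x)$ the number of those in which exactly $j$ tree edges are incident to the vertex $x$, and $F_j(N,x)=f_j(N,x)/f(N)$. *)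

theory Defs
  imports Complex_Main "HOL-Library.Product_Plus"
begin

text \<open>
  Graphs are simple and undirected: a set of vertices together with a set of two-element edge sets.
\<close>

definition graph_connected :: "'a set \<Rightarrow> 'a set set \<Rightarrow> bool" where
  "graph_connected V E \<longleftrightarrow>
     V \<noteq> {} \<and> (\<forall>u\<in>V. \<forall>v\<in>V. (u, v) \<in> {(x, y). {x, y} \<in> E}\<^sup>*)"

text \<open>A cycle is given by the list of its vertices, without repeating the first one at the end.\<close>

definition graph_cycle :: "'a set set \<Rightarrow> 'a list \<Rightarrow> bool" where
  "graph_cycle E p \<longleftrightarrow>
     3 \<le> length p \<and> distinct p \<and> (\<forall>i<length p. {p ! i, p ! (Suc i mod length p)} \<in> E)"

definition is_tree :: "'a set \<Rightarrow> 'a set set \<Rightarrow> bool" where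
  "is_tree V E \<longleftrightarrow> graph_connected V E \<and> (\<nexists>p. graph_cycle E p)"

text \<open>A spanning tree is identified with its set of edges.\<close>

definition spanning_trees :: "'a set \<Rightarrow> 'a set set \<Rightarrow> 'a set set set" where
  "spanning_trees V E = {T. T \<subseteq> E \<and> is_tree V T}"

text \<open>
  The Sierpinski gasket graph is drawn in the triangular lattice: the pair \<open>(i, j)\<close> stands for
  the point \<open>i (1, 0) + j (1/2, sqrt 3 / 2)\<close> of the plane.  The outmost vertices of \<open>SG(n)\<close> are
  then \<open>(0, 0)\<close>, \<open>(2^n, 0)\<close> and \<open>(0, 2^n)\<close>, and the identifications in the recursive
  construction are automatic, since the identified vertices are the same lattice point
  (the lemmas \<open>SG_verts_lower_copies\<close> to \<open>SG_verts_upper_copies\<close> below show that nothing else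
  is identified).  The lower-left copy of \<open>SG(k)\<close> is literally contained in \<open>SG(N)\<close> for
  \<open>k \<le> N\<close>.
\<close>

fun SG_verts :: "nat \<Rightarrow> (nat \<times> nat) set" where
  "SG_verts 0 = {(0, 0), (1, 0), (0, 1)}"
| "SG_verts (Suc n) =
     SG_verts n \<union> (+) (2 ^ n, 0) ` SG_verts n \<union> (+) (0, 2 ^ n) ` SG_verts n"

fun SG_edges :: "nat \<Rightarrow> (nat \<times> nat) set set" where
  "SG_edges 0 = {{(0, 0), (1, 0)}, {(0, 0), (0, 1)}, {(1, 0), (0, 1)}}"
| "SG_edges (Suc n) =
     SG_edges n \<union> image ((+) (2 ^ n, 0)) ` SG_edges n \<union> image ((+) (0, 2 ^ n)) ` SG_edges n"

definition SG_a :: "nat \<Rightarrow> nat \<times> nat" where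
  "SG_a n = (2 ^ n, 0)"

definition SG_b :: "nat \<Rightarrow> nat \<times> nat" where
  "SG_b n = (0, 2 ^ n)"

text \<open>
  The rightmost vertex \<open>(0, 2^n) + (2^n, 0)\<close> of the top copy of \<open>SG(n)\<close> in \<open>SG(n+1)\<close>, which is
  also the topmost vertex \<open>(2^n, 0) + (0, 2^n)\<close> of the lower-right copy.
\<close>

definition SG_c :: "nat \<Rightarrow> nat \<times> nat" where
  "SG_c n = (2 ^ n, 2 ^ n)"

definition SG_f :: "nat \<Rightarrow> nat" where
  "SG_f N = card (spanning_trees (SG_verts N) (SG_edges N))"

definition SG_fj :: "nat \<Rightarrow> nat \<Rightarrow> nat \<times> nat \<Rightarrow> nat" where
  "SG_fj j N x =
     card {T \<in> spanning_trees (SG_verts N) (SG_edges N). card {e \<in> T. x \<in> e} = j}"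

definition SG_F :: "nat \<Rightarrow> nat \<Rightarrow> nat \<times> nat \<Rightarrow> real" where
  "SG_F j N x = real (SG_fj j N x) / real (SG_f N)"

lemma SG_verts_bound: "p \<in> SG_verts n \<Longrightarrow> fst p + snd p \<le> 2 ^ n"
proof (induction n arbitrary: p)
  case (Suc n)
  consider "p \<in> SG_verts n"
    | q where "q \<in> SG_verts n" "p = (2 ^ n, 0) + q"
    | q where "q \<in> SG_verts n" "p = (0, 2 ^ n) + q"
    using Suc.prems by auto
  then show ?case
  proof cases
    case 1
    then show ?thesis using Suc.IH[OF 1] by simp
  next
    case 2
    then show ?thesis using Suc.IH[OF 2(1)] by simp
  next
    case 3
    then show ?thesis using Suc.IH[OF 3(1)] by simp
  qed
qed auto

lemma SG_outmost_verts: "(0, 0) \<in> SG_verts n" "SG_a n \<in> SG_verts n" "SG_b n \<in> SG_verts n"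
proof -
  have "(0, 0) \<in> SG_verts n \<and> (2 ^ n, 0) \<in> SG_verts n \<and> (0, 2 ^ n) \<in> SG_verts n"
  proof (induction n)
    case (Suc n)
    have "(2 ^ Suc n, 0) = (2 ^ n, 0) + (2 ^ n :: nat, 0 :: nat)"
      "(0, 2 ^ Suc n) = (0, 2 ^ n) + (0 :: nat, 2 ^ n :: nat)" by simp_all
    with Suc show ?case by (metis SG_verts.simps(2) UnI1 UnI2 imageI)
  qed auto
  then show "(0, 0) \<in> SG_verts n" "SG_a n \<in> SG_verts n" "SG_b n \<in> SG_verts n"
    by (auto simp: SG_a_def SG_b_def)
qed

lemma SG_verts_lower_copies:
  "SG_verts n \<inter> (+) (2 ^ n, 0) ` SG_verts n = {SG_a n}"
proof -
  have "SG_a n = (2 ^ n, 0) + (0, 0)" by (simp add: SG_a_def)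
  then have "SG_a n \<in> (+) (2 ^ n, 0) ` SG_verts n"
    using SG_outmost_verts(1) by (metis imageI)
  moreover have "(2 ^ n, 0) + q = SG_a n" if "(2 ^ n, 0) + q \<in> SG_verts n" for q
    using SG_verts_bound[OF that] by (cases q) (simp add: SG_a_def)
  ultimately show ?thesis using SG_outmost_verts(2)[of n] by blast
qed

lemma SG_verts_left_copies:
  "SG_verts n \<inter> (+) (0, 2 ^ n) ` SG_verts n = {SG_b n}"
proof -
  have "SG_b n = (0, 2 ^ n) + (0, 0)" by (simp add: SG_b_def)
  then have "SG_b n \<in> (+) (0, 2 ^ n) ` SG_verts n"
    using SG_outmost_verts(1) by (metis imageI)
  moreover have "(0, 2 ^ n) + q = SG_b n" if "(0, 2 ^ n) + q \<in> SG_verts n" for q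
    using SG_verts_bound[OF that] by (cases q) (simp add: SG_b_def)
  ultimately show ?thesis using SG_outmost_verts(3)[of n] by blast
qed

lemma SG_verts_upper_copies:
  "(+) (2 ^ n, 0) ` SG_verts n \<inter> (+) (0, 2 ^ n) ` SG_verts n = {SG_c n}"
proof -
  have "SG_c n = (2 ^ n, 0) + SG_b n" "SG_c n = (0, 2 ^ n) + SG_a n"
    by (simp_all add: SG_a_def SG_b_def SG_c_def)
  then have "SG_c n \<in> (+) (2 ^ n, 0) ` SG_verts n \<inter> (+) (0, 2 ^ n) ` SG_verts n"
    using SG_outmost_verts(2,3) by (metis IntI imageI)
  moreover have "(2 ^ n, 0) + q = SG_c n"
    if "q \<in> SG_verts n" "r \<in> SG_verts n" "(2 ^ n, 0) + q = (0, 2 ^ n) + r" for q r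
    using SG_verts_bound[OF that(1)] SG_verts_bound[OF that(2)] that(3)
    by (cases q; cases r) (simp add: SG_c_def)
  ultimately show ?thesis by blast
qed

lemma SG_edges_subset: "e \<in> SG_edges n \<Longrightarrow> e \<subseteq> SG_verts n \<and> card e = 2"
proof (induction n arbitrary: e)
  case (Suc n)
  consider "e \<in> SG_edges n"
    | d where "d \<in> SG_edges n" "e = (+) (2 ^ n, 0) ` d"
    | d where "d \<in> SG_edges n" "e = (+) (0, 2 ^ n) ` d"
    using Suc.prems by auto
  then show ?case
  proof cases
    case 1
    then show ?thesis using Suc.IH by auto
  next
    case 2
    have "d \<subseteq> SG_verts n" "card d = 2" using Suc.IH[OF 2(1)] by simp_all
    moreover have "card e = card d" unfolding 2(2) by (rule card_image) (simp add: inj_on_def)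
    ultimately show ?thesis using 2(2) by auto
  next
    case 3
    have "d \<subseteq> SG_verts n" "card d = 2" using Suc.IH[OF 3(1)] by simp_all
    moreover have "card e = card d" unfolding 3(2) by (rule card_image) (simp add: inj_on_def)
    ultimately show ?thesis using 3(2) by auto
  qed
qed auto

lemma SG_verts_mono: "k \<le> N \<Longrightarrow> SG_verts k \<subseteq> SG_verts N"
  by (induction N rule: dec_induct) auto

lemma SG_edges_mono: "k \<le> N \<Longrightarrow> SG_edges k \<subseteq> SG_edges N"
  by (induction N rule: dec_induct) auto

end

theory Submission
  imports Defs
begin

text \<open>
  An edge set of \<open>SG(n + 1)\<close> is a triple of edge sets of \<open>SG(n)\<close>, and whether it is a spanning tree depends
  only on how the components of the three parts partition the corners of the three copies.  Components
  are detected by the vertex sets closed under adjacency: there are \<open>2\<^sup>c\<close> of them for \<open>c\<close> components,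
  and they glue along the common corners.  Sorting spanning forests by the five partitions of the corners
  gives a cubic recursion for forest sums weighted by \<open>z\<close> to the degree of a vertex.

  Unweighted, the five sums are in the proportion \<open>1 : \<rho> : \<rho> : \<rho> : 3\<rho>\<^sup>2\<close> with \<open>\<rho> = (5/3)\<^sup>n / 3\<close>.
  After division by them, the recursion for a corner of \<open>SG(n)\<close> is linear with constant coefficients and is
  solved by powers of \<open>1, 1/15, 3/5, 1/25\<close>.  The vertices \<open>a\<^sub>n\<close> and \<open>c\<^sub>n\<close> of \<open>SG(n + 1)\<close> are common corners
  of two copies, hence bilinear in these solutions, and the \<open>m\<close> further levels are linear again.
\<close>

section \<open>Trees and closed vertex sets\<close>

text \<open>Paths and cycles may run through all three copies and do not split well along the
  gluing. Closed sets do: a closed set of the glued graph is a matching triple of closed sets. Under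
  symmetric difference they form a vector space over the field with two elements whose dimension is
  the number of components, so that connectedness and acyclicity become a dimension and an edge
  count, and edge counts add up over the copies. The number \<open>\<rho>\<close> is half the
  effective resistance between two corners (2/3 in the triangle), and 5/3 is the resistance scaling
  of the gasket. As each of the five recursions is homogeneous in \<open>\<rho>\<close>, passing
  from sums to means removes all dependence on \<open>n\<close> from the coefficients. The weight
  carries the whole degree distribution as a polynomial in \<open>z\<close>. In the limit a corner
  has the polynomial (11z + 3z^2)/14, and its square supplies the constants 121/196, 33/98 and
  9/196. The other powers are products of those for single corners: 1/225 = (1/15)^2 and 1/375 =
  1/25 * 1/15. No (9/25)^n appears, since in each product that is used at least one factor has only
  the powers of 1 and 1/15.\<close>

definition closed_sets :: "'a set \<Rightarrow> 'a set set \<Rightarrow> 'a set set" where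
  "closed_sets V T = {S. S \<subseteq> V \<and> (\<forall>e\<in>T. e \<subseteq> S \<or> e \<inter> S = {})}"

lemma closed_setsD: "S \<in> closed_sets V T \<Longrightarrow> S \<subseteq> V"
  by (simp add: closed_sets_def)

lemma finite_closed_sets: "finite V \<Longrightarrow> finite (closed_sets V T)"
  by (rule finite_subset[of _ "Pow V"]) (auto simp: closed_sets_def)

lemma empty_in_closed_sets: "{} \<in> closed_sets V T"
  by (simp add: closed_sets_def)

lemma sym_diff_in_closed_sets:
  assumes "S \<in> closed_sets V T" "S' \<in> closed_sets V T"
  shows "sym_diff S S' \<in> closed_sets V T"
proof -
  have "e \<subseteq> sym_diff S S' \<or> e \<inter> sym_diff S S' = {}" if "e \<in> T" for e
  proof -
    have "e \<subseteq> S \<or> e \<inter> S = {}" "e \<subseteq> S' \<or> e \<inter> S' = {}"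
      using assms that by (auto simp: closed_sets_def)
    then show ?thesis by blast
  qed
  moreover have "sym_diff S S' \<subseteq> V" using assms by (auto simp: closed_sets_def)
  ultimately show ?thesis by (simp add: closed_sets_def)
qed

lemma inj_sym_diff: "inj (\<lambda>S. sym_diff S S0)"
  by (rule injI) blast

lemma closed_sets_insert:
  "closed_sets V (insert {u, v} T) = {S \<in> closed_sets V T. u \<in> S \<longleftrightarrow> v \<in> S}"
  by (auto simp: closed_sets_def)

text \<open>
  Taking the symmetric difference with one fixed closed set that separates \<open>u\<close> from \<open>v\<close> exchanges
  the closed sets that separate them with those that do not, so a new edge \<open>{u, v}\<close> either halves the
  number of closed sets or leaves it unchanged.
\<close>

lemma card_closed_sets_insert_le:
  assumes "finite V"
  shows "card (closed_sets V T) \<le> 2 * card (closed_sets V (insert {u, v} T))"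
proof -
  let ?G = "closed_sets V (insert {u, v} T)"
  let ?B = "{S \<in> closed_sets V T. \<not> (u \<in> S \<longleftrightarrow> v \<in> S)}"
  have "closed_sets V T = ?G \<union> ?B" by (auto simp: closed_sets_insert)
  then have "card (closed_sets V T) \<le> card ?G + card ?B" by (metis card_Un_le)
  moreover have "card ?B \<le> card ?G"
  proof (cases "?B = {}")
    case False
    then obtain S0 where S0: "S0 \<in> ?B" by blast
    show ?thesis
    proof (rule card_inj_on_le)
      show "inj_on (\<lambda>S. sym_diff S S0) ?B" using inj_sym_diff by (rule inj_on_subset) simp
      show "(\<lambda>S. sym_diff S S0) ` ?B \<subseteq> ?G"
      proof (rule image_subsetI)
        fix S assume "S \<in> ?B"
        with S0 show "sym_diff S S0 \<in> ?G"
          using sym_diff_in_closed_sets[of S V T S0] by (auto simp: closed_sets_insert)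
      qed
      show "finite ?G" by (rule finite_closed_sets[OF assms])
    qed
  next
    case True
    show ?thesis unfolding True by simp
  qed
  ultimately show ?thesis by simp
qed

lemma card_closed_sets_insert_separated:
  assumes "finite V" and S0: "S0 \<in> closed_sets V T" "u \<in> S0" "v \<notin> S0"
  shows "2 * card (closed_sets V (insert {u, v} T)) \<le> card (closed_sets V T)"
proof -
  let ?G = "closed_sets V (insert {u, v} T)"
  let ?B = "{S \<in> closed_sets V T. \<not> (u \<in> S \<longleftrightarrow> v \<in> S)}"
  have B: "finite ?B" using finite_closed_sets[OF assms(1)] by simp
  have "card ?G \<le> card ?B"
  proof (rule card_inj_on_le)
    show "inj_on (\<lambda>S. sym_diff S S0) ?G" using inj_sym_diff by (rule inj_on_subset) simp
    show "(\<lambda>S. sym_diff S S0) ` ?G \<subseteq> ?B"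
    proof (rule image_subsetI)
      fix S assume "S \<in> ?G"
      with S0 show "sym_diff S S0 \<in> ?B"
        using sym_diff_in_closed_sets[of S V T S0] by (auto simp: closed_sets_insert)
    qed
  qed (rule B)
  moreover have "card (?G \<union> ?B) = card ?G + card ?B"
    using finite_closed_sets[OF assms(1)] B by (intro card_Un_disjoint) (auto simp: closed_sets_insert)
  moreover have "?G \<union> ?B = closed_sets V T" by (auto simp: closed_sets_insert)
  ultimately show ?thesis by simp
qed

text \<open>Without edges all \<open>2 ^ card V\<close> subsets are closed, and each edge at most
  halves their number. In exponents: there are at least \<open>card V - card T\<close>
  components.\<close>

lemma card_closed_sets_ge:
  assumes "finite V" "finite T" "\<forall>e\<in>T. card e = 2"
  shows "2 ^ card V \<le> 2 ^ card T * card (closed_sets V T)"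
  using assms(2,3)
proof (induction T)
  case empty
  have "closed_sets V {} = Pow V" by (auto simp: closed_sets_def)
  then show ?case by (simp add: card_Pow assms(1))
next
  case (insert e T)
  obtain u v where e: "e = {u, v}" using insert.prems by (auto simp: card_2_iff)
  have "2 ^ card V \<le> 2 ^ card T * card (closed_sets V T)" using insert by simp
  also have "\<dots> \<le> 2 ^ card T * (2 * card (closed_sets V (insert e T)))"
    unfolding e by (intro mult_left_mono card_closed_sets_insert_le[OF assms(1)]) simp
  finally show ?case using insert.hyps by simp
qed

section \<open>Connectedness and cycles in terms of closed sets\<close>

abbreviation adjacent :: "'a set set \<Rightarrow> ('a \<times> 'a) set" where
  "adjacent T \<equiv> {(x, y). {x, y} \<in> T}"

lemma closed_sets_rtrancl:
  assumes "S \<in> closed_sets V T" "(x, y) \<in> (adjacent T)\<^sup>*" "x \<in> S"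
  shows "y \<in> S"
  using assms(2,3,1) by (induction) (auto simp: closed_sets_def)

lemma component_in_closed_sets:
  assumes "\<forall>e\<in>T. e \<subseteq> V \<and> card e = 2"
  shows "{y \<in> V. (u, y) \<in> (adjacent T)\<^sup>*} \<in> closed_sets V T"
proof -
  let ?S = "{y \<in> V. (u, y) \<in> (adjacent T)\<^sup>*}"
  have "e \<subseteq> ?S \<or> e \<inter> ?S = {}" if "e \<in> T" for e
  proof -
    from assms that have "card e = 2" by blast
    then obtain x y where e: "e = {x, y}" by (meson card_2_iff)
    then have "(x, y) \<in> adjacent T" "(y, x) \<in> adjacent T" using that by (auto simp: insert_commute)
    then have "(u, x) \<in> (adjacent T)\<^sup>* \<longleftrightarrow> (u, y) \<in> (adjacent T)\<^sup>*"
      by (meson rtrancl.rtrancl_into_rtrancl)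
    moreover have "x \<in> V" "y \<in> V" using assms that e by auto
    ultimately show ?thesis unfolding e by auto
  qed
  then show ?thesis by (auto simp: closed_sets_def)
qed

lemma graph_connected_iff_closed_sets:
  assumes "\<forall>e\<in>T. e \<subseteq> V \<and> card e = 2" "V \<noteq> {}"
  shows "graph_connected V T \<longleftrightarrow> closed_sets V T = {{}, V}"
proof
  assume c: "graph_connected V T"
  have "S = {} \<or> S = V" if S: "S \<in> closed_sets V T" for S
  proof (rule disjCI)
    assume "S \<noteq> V"
    moreover have "S \<subseteq> V" using S by (simp add: closed_sets_def)
    ultimately obtain v where v: "v \<in> V" "v \<notin> S" by blast
    show "S = {}"
    proof (rule ccontr)
      assume "S \<noteq> {}"
      then obtain u where "u \<in> S" by blast
      with v c \<open>S \<subseteq> V\<close> closed_sets_rtrancl[OF S] show False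
        unfolding graph_connected_def by blast
    qed
  qed
  moreover have "V \<in> closed_sets V T" using assms by (auto simp: closed_sets_def)
  ultimately show "closed_sets V T = {{}, V}" using empty_in_closed_sets by blast
next
  assume c: "closed_sets V T = {{}, V}"
  have "(u, v) \<in> (adjacent T)\<^sup>*" if "u \<in> V" "v \<in> V" for u v
    using component_in_closed_sets[OF assms(1), of u] that unfolding c by blast
  then show "graph_connected V T" using assms(2) by (auto simp: graph_connected_def)
qed

lemma rtrancl_imp_distinct_path:
  assumes "(u, v) \<in> (adjacent T)\<^sup>*"
  shows "\<exists>p. p \<noteq> [] \<and> hd p = u \<and> last p = v \<and> distinct p \<and>
           (\<forall>i. Suc i < length p \<longrightarrow> {p ! i, p ! Suc i} \<in> T)"
  using assms
proof induction
  case base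
  show ?case by (rule exI[of _ "[u]"]) simp
next
  case (step y z)
  then obtain p where p: "p \<noteq> []" "hd p = u" "last p = y" "distinct p"
    "\<forall>i. Suc i < length p \<longrightarrow> {p ! i, p ! Suc i} \<in> T" by blast
  show ?case
  proof (cases "z \<in> set p")
    case True
    then obtain k where k: "k < length p" "p ! k = z" by (auto simp: in_set_conv_nth)
    \<comment> \<open>When the walk returns to a vertex already visited, the path is cut off there
      and stays distinct.\<close>
    have "last (take (Suc k) p) = z" using p(1) k by (simp add: take_Suc_conv_app_nth)
    then show ?thesis
      by (intro exI[of _ "take (Suc k) p"]) (use p k in auto)
  next
    case False
    have "{(p @ [z]) ! i, (p @ [z]) ! Suc i} \<in> T" if "Suc i < length (p @ [z])" for i
    proof (cases "Suc i < length p")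
      case True
      then show ?thesis using p by (simp add: nth_append)
    next
      case False
      then have "i = length p - 1" "Suc i = length p" using that by auto
      then show ?thesis using p step by (simp add: nth_append last_conv_nth)
    qed
    then show ?thesis
      by (intro exI[of _ "p @ [z]"]) (use p False in auto)
  qed
qed

text \<open>A distinct path from \<open>u\<close> to \<open>v\<close> in \<open>T\<close> would be
  closed to a cycle by the new edge. It has at least three vertices, because a path of two would be
  the edge \<open>{u, v}\<close> itself.\<close>

lemma acyclic_insert_imp_separated:
  assumes "\<nexists>p. graph_cycle (insert {u, v} T) p" "{u, v} \<notin> T" "u \<noteq> v"
  shows "(u, v) \<notin> (adjacent T)\<^sup>*"
proof
  assume "(u, v) \<in> (adjacent T)\<^sup>*"
  then obtain p where p: "p \<noteq> []" "hd p = u" "last p = v" "distinct p"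
    "\<forall>i. Suc i < length p \<longrightarrow> {p ! i, p ! Suc i} \<in> T"
    using rtrancl_imp_distinct_path by metis
  have ends: "p ! 0 = u" "p ! (length p - 1) = v" using p by (auto simp: hd_conv_nth last_conv_nth)
  have "length p \<noteq> 0" "length p \<noteq> 1" using p ends assms(3) by auto
  moreover have "length p \<noteq> 2"
  proof
    assume "length p = 2"
    then show False using p(5)[rule_format, of 0] ends assms(2) by simp
  qed
  ultimately have len: "3 \<le> length p" by linarith
  have "{p ! i, p ! (Suc i mod length p)} \<in> insert {u, v} T" if "i < length p" for i
  proof (cases "Suc i < length p")
    case True
    then show ?thesis using p by simp
  next
    case False
    then have "i = length p - 1" "Suc i = length p" using that by auto
    then show ?thesis using ends by (auto simp: insert_commute)
  qed
  then have "graph_cycle (insert {u, v} T) p" using len p by (simp add: graph_cycle_def)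
  then show False using assms(1) by blast
qed

text \<open>In an acyclic set every added edge joins two different components and so really halves
  the count; with \<open>card_closed_sets_ge\<close> the number of components is then exactly
  \<open>card V - card T\<close>.\<close>

lemma card_closed_sets_acyclic:
  assumes "finite V" "finite T" "\<forall>e\<in>T. e \<subseteq> V \<and> card e = 2" "\<nexists>p. graph_cycle T p"
  shows "2 ^ card T * card (closed_sets V T) \<le> 2 ^ card V"
  using assms(2-4)
proof (induction T)
  case empty
  have "closed_sets V {} = Pow V" by (auto simp: closed_sets_def)
  then show ?case by (simp add: card_Pow assms(1))
next
  case (insert e T)
  obtain u v where e: "e = {u, v}" "u \<noteq> v" using insert.prems by (auto simp: card_2_iff)
  have "(u, v) \<notin> (adjacent T)\<^sup>*"
    using acyclic_insert_imp_separated[of u v T] insert.hyps insert.prems e by auto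
  moreover have "u \<in> V" "v \<in> V" using insert.prems e by auto
  \<comment> \<open>The component of \<open>u\<close> is the closed set that separates
    \<open>u\<close> from \<open>v\<close>.\<close>
  moreover have "{y \<in> V. (u, y) \<in> (adjacent T)\<^sup>*} \<in> closed_sets V T"
    using insert.prems by (intro component_in_closed_sets) auto
  ultimately have sep: "2 * card (closed_sets V (insert e T)) \<le> card (closed_sets V T)"
    unfolding e(1)
    by (intro card_closed_sets_insert_separated
      [OF assms(1), of "{y \<in> V. (u, y) \<in> (adjacent T)\<^sup>*}"]) auto
  have "2 ^ card (insert e T) * card (closed_sets V (insert e T))
      = 2 ^ card T * (2 * card (closed_sets V (insert e T)))" using insert.hyps by simp
  also have "\<dots> \<le> 2 ^ card T * card (closed_sets V T)"
    by (rule mult_left_mono[OF sep]) simp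
  also have "\<dots> \<le> 2 ^ card V"
  proof (rule insert.IH)
    show "\<forall>e\<in>T. e \<subseteq> V \<and> card e = 2" using insert.prems by simp
    show "\<nexists>p. graph_cycle T p" using insert.prems by (auto simp: graph_cycle_def)
  qed
  finally show ?case .
qed

text \<open>If \<open>T\<close> is a tree, the two bounds on the number of closed sets meet and give
  the edge count. Conversely, deleting one edge of a cycle would leave the closed sets unchanged,
  and the lower bound for the smaller edge set would force
  \<open>card V \<le> card T\<close>.\<close>

lemma is_tree_iff_closed_sets:
  assumes V: "finite V" "V \<noteq> {}" and T: "\<forall>e\<in>T. e \<subseteq> V \<and> card e = 2"
  shows "is_tree V T \<longleftrightarrow> closed_sets V T = {{}, V} \<and> card T + 1 = card V"
proof -
  have fin: "finite T" using T V(1) by (intro finite_subset[of T "Pow V"]) auto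
  have two: "card {{}, V} = 2" using V(2) by simp
  show ?thesis
  proof (intro iffI conjI)
    assume t: "is_tree V T"
    then show c: "closed_sets V T = {{}, V}"
      using graph_connected_iff_closed_sets[OF T V(2)] by (simp add: is_tree_def)
    have "2 ^ card T * card (closed_sets V T) = 2 ^ card V"
      using card_closed_sets_acyclic[OF V(1) fin T] card_closed_sets_ge[OF V(1) fin] t T
      by (intro antisym) (simp_all add: is_tree_def)
    then have "(2::nat) ^ (card T + 1) = 2 ^ card V" unfolding c two by simp
    then show "card T + 1 = card V" by (simp del: power_Suc add_Suc_right)
  next
    assume a: "closed_sets V T = {{}, V} \<and> card T + 1 = card V"
    have "\<not> graph_cycle T p" for p
    proof
      assume p: "graph_cycle T p"
      let ?k = "length p"
      let ?e = "{p ! (?k - 1), p ! 0}"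
      have k: "3 \<le> ?k" and d: "distinct p" using p by (auto simp: graph_cycle_def)
      \<comment> \<open>The other edges of the cycle differ from the closing edge \<open>?e\<close>:
        equality would force \<open>i = 0\<close> and \<open>Suc i = ?k - 1\<close>, hence a cycle
        with two vertices only.\<close>
      have edge: "{p ! i, p ! Suc i} \<in> T - {?e}" if "Suc i < ?k" for i
      proof -
        have "{p ! i, p ! (Suc i mod ?k)} \<in> T" using p that
          unfolding graph_cycle_def by (meson Suc_lessD)
        moreover have "{p ! i, p ! Suc i} \<noteq> ?e"
        proof
          assume eq: "{p ! i, p ! Suc i} = ?e"
          have "p ! i \<noteq> p ! (?k - 1)"
            using d that k by (subst nth_eq_iff_index_eq) auto
          moreover have "p ! Suc i \<noteq> p ! 0" using d that k by (subst nth_eq_iff_index_eq) auto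
          ultimately have "p ! i = p ! 0" "p ! Suc i = p ! (?k - 1)"
            using eq by (auto simp: doubleton_eq_iff)
          moreover have "0 < ?k" "i < ?k" "?k - 1 < ?k" using that by linarith+
          ultimately have "i = 0" "Suc i = ?k - 1"
            using that nth_eq_iff_index_eq[OF d] by metis+
          then show False using k by simp
        qed
        ultimately show ?thesis using that by simp
      qed
      have e: "?e \<in> T"
      proof -
        have "{p ! (?k - 1), p ! (Suc (?k - 1) mod ?k)} \<in> T"
          using p k unfolding graph_cycle_def by (metis diff_less less_le_trans zero_less_numeral zero_less_one)
        moreover have "Suc (?k - 1) = ?k" using k by linarith
        ultimately show ?thesis by simp
      qed
      \<comment> \<open>Membership propagates along the remaining edges of the cycle, so its two
        ends agree already and \<open>?e\<close> imposes no new condition.\<close>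
      have "closed_sets V (T - {?e}) = closed_sets V (insert ?e (T - {?e}))"
      proof -
        have "p ! (?k - 1) \<in> S \<longleftrightarrow> p ! 0 \<in> S" if S: "S \<in> closed_sets V (T - {?e})" for S
        proof -
          have "p ! i \<in> S \<longleftrightarrow> p ! 0 \<in> S" if "i < ?k" for i
            using that
          proof (induction i)
            case (Suc i)
            have "{p ! i, p ! Suc i} \<subseteq> S \<or> {p ! i, p ! Suc i} \<inter> S = {}"
              using S edge[OF Suc.prems] unfolding closed_sets_def mem_Collect_eq by metis
            then have "p ! i \<in> S \<longleftrightarrow> p ! Suc i \<in> S" by blast
            then show ?case using Suc.IH Suc_lessD[OF Suc.prems] by metis
          qed simp
          moreover have "?k - 1 < ?k" using k by linarith
          ultimately show ?thesis by blast
        qed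
        then show ?thesis unfolding closed_sets_insert by blast
      qed
      also have "insert ?e (T - {?e}) = T" using e by blast
      finally have "card (closed_sets V (T - {?e})) = 2" using a two by simp
      then have "(2::nat) ^ card V \<le> 2 ^ card (T - {?e}) * 2"
        using card_closed_sets_ge[OF V(1), of "T - {?e}"] fin T by simp
      also have "card (T - {?e}) = card T - 1" using e by simp
      also have "(2::nat) ^ (card T - 1) * 2 = 2 ^ card T"
      proof -
        have "card T \<noteq> 0" using e fin by auto
        then show ?thesis by (metis power_minus_mult neq0_conv)
      qed
      finally have "card V \<le> card T" by simp
      then show False using a by simp
    qed
    then show "is_tree V T"
      using a graph_connected_iff_closed_sets[OF T V(2)] by (simp add: is_tree_def)
  qed
qed

section \<open>Gluing closed sets\<close>

lemma finite_SG_verts: "finite (SG_verts n)"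
  by (induction n) auto

lemma finite_SG_edges: "finite (SG_edges n)"
  by (induction n) auto

abbreviation shift_a :: "nat \<Rightarrow> nat \<times> nat \<Rightarrow> nat \<times> nat" where
  "shift_a n \<equiv> (+) (2 ^ n, 0)"

abbreviation shift_b :: "nat \<Rightarrow> nat \<times> nat \<Rightarrow> nat \<times> nat" where
  "shift_b n \<equiv> (+) (0, 2 ^ n)"

lemma shift_corners:
  "SG_a n = shift_a n (0, 0)" "SG_b n = shift_b n (0, 0)"
  "SG_c n = shift_a n (SG_b n)" "SG_c n = shift_b n (SG_a n)"
  "SG_a (Suc n) = shift_a n (SG_a n)" "SG_b (Suc n) = shift_b n (SG_b n)"
  by (simp_all add: SG_a_def SG_b_def SG_c_def)

lemma shift_a_in_SG_verts:
  assumes "y \<in> SG_verts n" "shift_a n y \<in> SG_verts n"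
  shows "y = (0, 0)"
proof -
  have "shift_a n y \<in> SG_verts n \<inter> shift_a n ` SG_verts n" using assms by blast
  then show ?thesis unfolding SG_verts_lower_copies by (cases y) (simp add: SG_a_def)
qed

lemma shift_b_in_SG_verts:
  assumes "y \<in> SG_verts n" "shift_b n y \<in> SG_verts n"
  shows "y = (0, 0)"
proof -
  have "shift_b n y \<in> SG_verts n \<inter> shift_b n ` SG_verts n" using assms by blast
  then show ?thesis unfolding SG_verts_left_copies by (cases y) (simp add: SG_b_def)
qed

lemma shift_a_eq_shift_b:
  assumes "y \<in> SG_verts n" "y' \<in> SG_verts n" "shift_a n y = shift_b n y'"
  shows "y = SG_b n" "y' = SG_a n"
proof -
  have "shift_a n y \<in> shift_a n ` SG_verts n \<inter> shift_b n ` SG_verts n" using assms by (metis IntI imageI)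
  then have "shift_a n y = SG_c n" unfolding SG_verts_upper_copies by simp
  with assms(3) show "y = SG_b n" "y' = SG_a n"
    by (cases y; cases y'; simp add: SG_a_def SG_b_def SG_c_def)+
qed

definition glue_verts ::
    "nat \<Rightarrow> (nat \<times> nat) set \<Rightarrow> (nat \<times> nat) set \<Rightarrow> (nat \<times> nat) set \<Rightarrow> (nat \<times> nat) set" where
  "glue_verts n S1 S2 S3 = S1 \<union> shift_a n ` S2 \<union> shift_b n ` S3"

definition glue_edges ::
    "nat \<Rightarrow> (nat \<times> nat) set set \<Rightarrow> (nat \<times> nat) set set \<Rightarrow> (nat \<times> nat) set set \<Rightarrow> (nat \<times> nat) set set" where
  "glue_edges n T1 T2 T3 = T1 \<union> image (shift_a n) ` T2 \<union> image (shift_b n) ` T3"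

text \<open>All three sets live in the coordinates of \<open>SG(n)\<close>. The equivalences express
  agreement at a_n, b_n and c_n, in this order, each seen from the two copies that share it.\<close>

definition matching ::
    "nat \<Rightarrow> (nat \<times> nat) set \<Rightarrow> (nat \<times> nat) set \<Rightarrow> (nat \<times> nat) set \<Rightarrow> bool" where
  "matching n S1 S2 S3 \<longleftrightarrow> (SG_a n \<in> S1 \<longleftrightarrow> (0, 0) \<in> S2) \<and> (SG_b n \<in> S1 \<longleftrightarrow> (0, 0) \<in> S3) \<and>
     (SG_b n \<in> S2 \<longleftrightarrow> SG_a n \<in> S3)"

text \<open>Different copies meet in a_n, b_n and c_n only, where \<open>matching\<close> makes the
  parts agree. Hence membership can be tested in any copy that contains the vertex.\<close>

lemma mem_glue_verts:
  assumes sub: "S1 \<subseteq> SG_verts n" "S2 \<subseteq> SG_verts n" "S3 \<subseteq> SG_verts n"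
    and m: "matching n S1 S2 S3" and x: "x \<in> SG_verts n"
  shows "x \<in> glue_verts n S1 S2 S3 \<longleftrightarrow> x \<in> S1"
    and "shift_a n x \<in> glue_verts n S1 S2 S3 \<longleftrightarrow> x \<in> S2"
    and "shift_b n x \<in> glue_verts n S1 S2 S3 \<longleftrightarrow> x \<in> S3"
proof -
  have inj: "shift_a n y = shift_a n z \<longleftrightarrow> y = z" "shift_b n y = shift_b n z \<longleftrightarrow> y = z" for y z
    by simp_all
  have a0: "y \<in> S1 \<longleftrightarrow> z \<in> S2" if "y \<in> SG_verts n" "z \<in> SG_verts n" "y = shift_a n z" for y z
  proof -
    have "z = (0, 0)" using that shift_a_in_SG_verts by blast
    then show ?thesis using that(3) m shift_corners(1) unfolding matching_def by metis
  qed
  have b0: "y \<in> S1 \<longleftrightarrow> z \<in> S3" if "y \<in> SG_verts n" "z \<in> SG_verts n" "y = shift_b n z" for y z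
  proof -
    have "z = (0, 0)" using that shift_b_in_SG_verts by blast
    then show ?thesis using that(3) m shift_corners(2) unfolding matching_def by metis
  qed
  have ab: "y \<in> S2 \<longleftrightarrow> z \<in> S3"
    if "y \<in> SG_verts n" "z \<in> SG_verts n" "shift_a n y = shift_b n z" for y z
    using shift_a_eq_shift_b[OF that] m unfolding matching_def by blast
  have iff: "y \<in> glue_verts n S1 S2 S3 \<longleftrightarrow>
      y \<in> S1 \<or> (\<exists>z\<in>S2. y = shift_a n z) \<or> (\<exists>z\<in>S3. y = shift_b n z)" for y
    by (simp only: glue_verts_def Un_iff image_iff disj_assoc)
  show "x \<in> glue_verts n S1 S2 S3 \<longleftrightarrow> x \<in> S1"
    unfolding iff using sub x a0[of x] b0[of x] by (meson subsetD)
  show "shift_a n x \<in> glue_verts n S1 S2 S3 \<longleftrightarrow> x \<in> S2"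
    unfolding iff inj using sub x a0[of "shift_a n x" x] ab[of x] by (meson subsetD)
  show "shift_b n x \<in> glue_verts n S1 S2 S3 \<longleftrightarrow> x \<in> S3"
    unfolding iff inj using sub x b0[of "shift_b n x" x] ab[OF _ x] by (metis subsetD)
qed

text \<open>The closed sets of the glued graph are the fibre product of those of the parts over the
  common corners: restriction to the copies is inverse to gluing, and every edge lies inside one
  copy.\<close>

lemma closed_sets_glue:
  assumes T: "T1 \<subseteq> SG_edges n" "T2 \<subseteq> SG_edges n" "T3 \<subseteq> SG_edges n"
  shows "S \<in> closed_sets (SG_verts (Suc n)) (glue_edges n T1 T2 T3) \<longleftrightarrow>
    (\<exists>S1 S2 S3. S1 \<in> closed_sets (SG_verts n) T1 \<and> S2 \<in> closed_sets (SG_verts n) T2 \<and>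
       S3 \<in> closed_sets (SG_verts n) T3 \<and> matching n S1 S2 S3 \<and> S = glue_verts n S1 S2 S3)"
    (is "?L \<longleftrightarrow> ?R")
proof
  assume L: ?L
  let ?V = "SG_verts n"
  let ?S1 = "{x \<in> ?V. x \<in> S}" and ?S2 = "{x \<in> ?V. shift_a n x \<in> S}" and ?S3 = "{x \<in> ?V. shift_b n x \<in> S}"
  have closed: "e \<subseteq> S \<or> e \<inter> S = {}" if "e \<in> glue_edges n T1 T2 T3" for e
    using L that by (auto simp: closed_sets_def)
  have "?S1 \<in> closed_sets ?V T1"
  proof -
    have "e \<subseteq> ?S1 \<or> e \<inter> ?S1 = {}" if "e \<in> T1" for e
      using closed[of e] SG_edges_subset[of e n] that T by (auto simp: glue_edges_def)
    then show ?thesis by (auto simp: closed_sets_def)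
  qed
  moreover have "?S2 \<in> closed_sets ?V T2"
  proof -
    have "e \<subseteq> ?S2 \<or> e \<inter> ?S2 = {}" if "e \<in> T2" for e
      using closed[of "shift_a n ` e"] SG_edges_subset[of e n] that T unfolding glue_edges_def by blast
    then show ?thesis by (auto simp: closed_sets_def)
  qed
  moreover have "?S3 \<in> closed_sets ?V T3"
  proof -
    have "e \<subseteq> ?S3 \<or> e \<inter> ?S3 = {}" if "e \<in> T3" for e
      using closed[of "shift_b n ` e"] SG_edges_subset[of e n] that T unfolding glue_edges_def by blast
    then show ?thesis by (auto simp: closed_sets_def)
  qed
  moreover have "matching n ?S1 ?S2 ?S3"
    using SG_outmost_verts[of n] shift_corners[of n] by (simp add: matching_def)
  moreover have "S = glue_verts n ?S1 ?S2 ?S3"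
    using L unfolding glue_verts_def closed_sets_def SG_verts.simps by blast
  ultimately show ?R by blast
next
  assume ?R
  then obtain S1 S2 S3 where S: "S1 \<in> closed_sets (SG_verts n) T1" "S2 \<in> closed_sets (SG_verts n) T2"
       "S3 \<in> closed_sets (SG_verts n) T3" "matching n S1 S2 S3" "S = glue_verts n S1 S2 S3" by blast
  then have sub: "S1 \<subseteq> SG_verts n" "S2 \<subseteq> SG_verts n" "S3 \<subseteq> SG_verts n" by (auto simp: closed_sets_def)
  note mem = mem_glue_verts[OF sub S(4), folded S(5)]
  have "S \<subseteq> SG_verts (Suc n)" using sub unfolding S(5) by (auto simp: glue_verts_def)
  moreover have "e \<subseteq> S \<or> e \<inter> S = {}" if e: "e \<in> glue_edges n T1 T2 T3" for e
  proof -
    consider "e \<in> T1" | d where "d \<in> T2" "e = shift_a n ` d" | d where "d \<in> T3" "e = shift_b n ` d"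
      using e unfolding glue_edges_def Un_iff image_iff by metis
    then show ?thesis
    proof cases
      case 1
      then have "e \<subseteq> SG_verts n" using T SG_edges_subset by blast
      moreover have "e \<subseteq> S1 \<or> e \<inter> S1 = {}" using S(1) 1 by (auto simp: closed_sets_def)
      ultimately show ?thesis using mem(1) by blast
    next
      case 2
      then have "d \<subseteq> SG_verts n" using T SG_edges_subset by blast
      moreover have "d \<subseteq> S2 \<or> d \<inter> S2 = {}" using S(2) 2 by (auto simp: closed_sets_def)
      ultimately show ?thesis using mem(2) unfolding 2(2) by blast
    next
      case 3
      then have "d \<subseteq> SG_verts n" using T SG_edges_subset by blast
      moreover have "d \<subseteq> S3 \<or> d \<inter> S3 = {}" using S(3) 3 by (auto simp: closed_sets_def)
      ultimately show ?thesis using mem(3) unfolding 3(2) by blast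
    qed
  qed
  ultimately show ?L by (simp add: closed_sets_def)
qed

text \<open>
  A closed set is a colouring of the vertices by two colours that is constant on the components;
  \<open>corner_colours\<close> records the colourings of the corners \<open>o\<close>, \<open>a\<^sub>n\<close>, \<open>b\<^sub>n\<close> that arise,
  hence how the components partition the corners, and \<open>rooted\<close> says that every component
  contains a corner.
\<close>

definition corner_colours :: "nat \<Rightarrow> (nat \<times> nat) set set \<Rightarrow> bool \<Rightarrow> bool \<Rightarrow> bool \<Rightarrow> bool" where
  "corner_colours n T p q r \<longleftrightarrow> (\<exists>S\<in>closed_sets (SG_verts n) T.
     ((0, 0) \<in> S \<longleftrightarrow> p) \<and> (SG_a n \<in> S \<longleftrightarrow> q) \<and> (SG_b n \<in> S \<longleftrightarrow> r))"

definition rooted :: "nat \<Rightarrow> (nat \<times> nat) set set \<Rightarrow> bool" where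
  "rooted n T \<longleftrightarrow> (\<forall>S\<in>closed_sets (SG_verts n) T.
     (0, 0) \<notin> S \<longrightarrow> SG_a n \<notin> S \<longrightarrow> SG_b n \<notin> S \<longrightarrow> S = {})"

text \<open>The five set partitions of the three corners; equivalently, the five subspaces of the
  colour triples over the two-element field that contain the all-true triple. \<open>blocks\<close>
  is the dimension of the subspace \<open>admits t\<close>.\<close>

datatype corner_type = Joined | Join_oa | Join_ob | Join_ab | Separate

fun admits :: "corner_type \<Rightarrow> bool \<Rightarrow> bool \<Rightarrow> bool \<Rightarrow> bool" where
  "admits Joined p q r \<longleftrightarrow> p = q \<and> q = r"
| "admits Join_oa p q r \<longleftrightarrow> p = q"
| "admits Join_ob p q r \<longleftrightarrow> p = r"
| "admits Join_ab p q r \<longleftrightarrow> q = r"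
| "admits Separate p q r \<longleftrightarrow> True"

fun blocks :: "corner_type \<Rightarrow> nat" where
  "blocks Joined = 1"
| "blocks Join_oa = 2"
| "blocks Join_ob = 2"
| "blocks Join_ab = 2"
| "blocks Separate = 3"

lemma UNIV_corner_type: "UNIV = {Joined, Join_oa, Join_ob, Join_ab, Separate}"
  using corner_type.exhaust by auto

instance corner_type :: finite
  by standard (simp add: UNIV_corner_type)

lemma inj_admits: "admits t = admits t' \<Longrightarrow> t = t'"
  by (cases t; cases t') (auto simp: fun_eq_iff)

lemma corner_colours_sym_diff:
  assumes "corner_colours n T p q r" "corner_colours n T p' q' r'"
  shows "corner_colours n T (p \<noteq> p') (q \<noteq> q') (r \<noteq> r')"
proof -
  obtain S S' where "S \<in> closed_sets (SG_verts n) T" "S' \<in> closed_sets (SG_verts n) T"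
    "((0, 0) \<in> S \<longleftrightarrow> p) \<and> (SG_a n \<in> S \<longleftrightarrow> q) \<and> (SG_b n \<in> S \<longleftrightarrow> r)"
    "((0, 0) \<in> S' \<longleftrightarrow> p') \<and> (SG_a n \<in> S' \<longleftrightarrow> q') \<and> (SG_b n \<in> S' \<longleftrightarrow> r')"
    using assms unfolding corner_colours_def by blast
  then show ?thesis
    unfolding corner_colours_def using sym_diff_in_closed_sets[of S _ T S']
    by (intro bexI[of _ "sym_diff S S'"]) auto
qed

lemma corner_colours_const:
  assumes "T \<subseteq> SG_edges n"
  shows "corner_colours n T True True True" "corner_colours n T False False False"
proof -
  have "SG_verts n \<in> closed_sets (SG_verts n) T"
    using assms SG_edges_subset by (auto simp: closed_sets_def)
  then show "corner_colours n T True True True"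
    unfolding corner_colours_def using SG_outmost_verts by blast
  from corner_colours_sym_diff[OF this this] show "corner_colours n T False False False" by simp
qed

text \<open>The colour triples that arise are closed under symmetric difference and contain the
  constant ones. Such a subspace is determined by its triples with first entry \<open>False\<close>,
  where any two of the three non-zero triples generate the third; this leaves five
  possibilities.\<close>

lemma ex_corner_type:
  assumes "T \<subseteq> SG_edges n"
  shows "\<exists>t. corner_colours n T = admits t"
proof -
  let ?C = "corner_colours n T"
  have const: "?C True True True" "?C False False False" using corner_colours_const[OF assms] by auto
  have sd: "?C p q r \<Longrightarrow> ?C p' q' r' \<Longrightarrow> ?C (p \<noteq> p') (q \<noteq> q') (r \<noteq> r')" for p q r p' q' r'
    by (rule corner_colours_sym_diff)
  \<comment> \<open>Adding the all-true triple complements a colouring, so only triples with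
    \<open>p = False\<close> have to be examined.\<close>
  have neg: "?C True q r \<longleftrightarrow> ?C False (\<not> q) (\<not> r)" for q r
    using sd[OF const(1), of True q r] sd[OF const(1), of False "\<not> q" "\<not> r"] by auto
  have *: "?C False True True \<Longrightarrow> ?C False True False \<Longrightarrow> ?C False False True"
    "?C False True True \<Longrightarrow> ?C False False True \<Longrightarrow> ?C False True False"
    "?C False False True \<Longrightarrow> ?C False True False \<Longrightarrow> ?C False True True"
    using sd[of False True True False True False] sd[of False True True False False True]
      sd[of False False True False True False] by simp_all
  consider "?C False True True" "?C False True False" "?C False False True"
    | "?C False True True" "\<not> ?C False True False" "\<not> ?C False False True"
    | "\<not> ?C False True True" "?C False True False" "\<not> ?C False False True"
    | "\<not> ?C False True True" "\<not> ?C False True False" "?C False False True"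
    | "\<not> ?C False True True" "\<not> ?C False True False" "\<not> ?C False False True"
    using * by blast
  then show ?thesis
  proof cases
    case 1
    have "?C = admits Separate"
      by (simp add: fun_eq_iff all_bool_eq neg const 1)
    then show ?thesis ..
  next
    case 2
    have "?C = admits Join_ab"
      by (simp add: fun_eq_iff all_bool_eq neg const 2)
    then show ?thesis ..
  next
    case 3
    have "?C = admits Join_ob"
      by (simp add: fun_eq_iff all_bool_eq neg const 3)
    then show ?thesis ..
  next
    case 4
    have "?C = admits Join_oa"
      by (simp add: fun_eq_iff all_bool_eq neg const 4)
    then show ?thesis ..
  next
    case 5
    have "?C = admits Joined"
      by (simp add: fun_eq_iff all_bool_eq neg const 5)
    then show ?thesis ..
  qed
qed

lemma card_admits: "card {(p, q, r). admits t p q r} = 2 ^ blocks t"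
proof -
  have eq: "{(p, q, r). admits t p q r} =
    (\<Union>p. \<Union>q. \<Union>r. if admits t p q r then {(p, q, r)} else {})"
    by (auto split: if_splits)
  show ?thesis unfolding eq by (cases t) (simp_all add: UNIV_bool)
qed

text \<open>In a rooted set a closed set is determined by its colours at the corners, for the
  symmetric difference of two with equal colours misses all corners. So there are at most
  \<open>2 ^ blocks t\<close> closed sets, which is compared with the lower bound from counting
  edges.\<close>

lemma card_SG_verts_le:
  assumes T: "T \<subseteq> SG_edges n" "rooted n T" "corner_colours n T = admits t"
  shows "card (SG_verts n) \<le> card T + blocks t"
proof -
  let ?C = "closed_sets (SG_verts n) T"
  let ?f = "\<lambda>S. ((0, 0) \<in> S, SG_a n \<in> S, SG_b n \<in> S)"
  have "card ?C \<le> card {(p, q, r). admits t p q r}"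
  proof (rule card_inj_on_le[of ?f])
    show "inj_on ?f ?C"
    proof (rule inj_onI)
      fix S S' assume S: "S \<in> ?C" "S' \<in> ?C" "?f S = ?f S'"
      have "(0, 0) \<notin> sym_diff S S'" "SG_a n \<notin> sym_diff S S'" "SG_b n \<notin> sym_diff S S'"
        using S(3) by auto
      then have "sym_diff S S' = {}"
        using T(2) sym_diff_in_closed_sets[OF S(1,2)] unfolding rooted_def by metis
      then show "S = S'" by blast
    qed
    show "?f ` ?C \<subseteq> {(p, q, r). admits t p q r}"
      unfolding T(3)[symmetric] by (auto simp: corner_colours_def)
  qed simp
  then have "card ?C \<le> 2 ^ blocks t" by (simp add: card_admits)
  moreover have "2 ^ card (SG_verts n) \<le> 2 ^ card T * card ?C"
    using T SG_edges_subset finite_subset[OF T(1) finite_SG_edges]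
    by (intro card_closed_sets_ge finite_SG_verts) auto
  ultimately have "(2::nat) ^ card (SG_verts n) \<le> 2 ^ card T * 2 ^ blocks t"
    by (meson le_trans mult_le_mono2)
  then show ?thesis by (simp flip: power_add)
qed

section \<open>Gluing forests\<close>

lemma glue_corners:
  assumes "S1 \<in> closed_sets (SG_verts n) T1" "S2 \<in> closed_sets (SG_verts n) T2"
    "S3 \<in> closed_sets (SG_verts n) T3" "matching n S1 S2 S3"
  shows "(0, 0) \<in> glue_verts n S1 S2 S3 \<longleftrightarrow> (0, 0) \<in> S1"
    "SG_a (Suc n) \<in> glue_verts n S1 S2 S3 \<longleftrightarrow> SG_a n \<in> S2"
    "SG_b (Suc n) \<in> glue_verts n S1 S2 S3 \<longleftrightarrow> SG_b n \<in> S3"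
proof -
  note m = mem_glue_verts[OF assms(1-3)[THEN closed_setsD] assms(4)]
  show "(0, 0) \<in> glue_verts n S1 S2 S3 \<longleftrightarrow> (0, 0) \<in> S1"
    by (rule m(1)[OF SG_outmost_verts(1)])
  show "SG_a (Suc n) \<in> glue_verts n S1 S2 S3 \<longleftrightarrow> SG_a n \<in> S2"
    unfolding shift_corners(5) by (rule m(2)[OF SG_outmost_verts(2)])
  show "SG_b (Suc n) \<in> glue_verts n S1 S2 S3 \<longleftrightarrow> SG_b n \<in> S3"
    unfolding shift_corners(6) by (rule m(3)[OF SG_outmost_verts(3)])
qed

text \<open>The bound \<open>x\<close>, \<open>y\<close>, \<open>c\<close> are the colours of the
  inner vertices a_n, b_n, c_n, while \<open>p\<close>, \<open>q\<close>, \<open>r\<close> are those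
  of the outmost vertices. This is \<open>closed_sets_glue\<close> seen at the corners only.\<close>

lemma corner_colours_glue:
  assumes T: "T1 \<subseteq> SG_edges n" "T2 \<subseteq> SG_edges n" "T3 \<subseteq> SG_edges n"
  shows "corner_colours (Suc n) (glue_edges n T1 T2 T3) p q r \<longleftrightarrow>
    (\<exists>x y c. corner_colours n T1 p x y \<and> corner_colours n T2 x q c \<and> corner_colours n T3 y c r)"
    (is "?L \<longleftrightarrow> ?R")
proof
  assume ?L
  then obtain S where S: "S \<in> closed_sets (SG_verts (Suc n)) (glue_edges n T1 T2 T3)"
    "(0, 0) \<in> S \<longleftrightarrow> p" "SG_a (Suc n) \<in> S \<longleftrightarrow> q" "SG_b (Suc n) \<in> S \<longleftrightarrow> r"
    unfolding corner_colours_def by blast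
  obtain S1 S2 S3 where s: "S1 \<in> closed_sets (SG_verts n) T1" "S2 \<in> closed_sets (SG_verts n) T2"
    "S3 \<in> closed_sets (SG_verts n) T3" "matching n S1 S2 S3" "S = glue_verts n S1 S2 S3"
    using S(1) unfolding closed_sets_glue[OF T] by blast
  note g = glue_corners[OF s(1-4), folded s(5)]
  have "corner_colours n T1 p (SG_a n \<in> S1) (SG_b n \<in> S1)"
    unfolding corner_colours_def using S g by (intro bexI[OF _ s(1)]) simp
  moreover have "corner_colours n T2 (SG_a n \<in> S1) q (SG_b n \<in> S2)"
    unfolding corner_colours_def using S g s(4) by (intro bexI[OF _ s(2)]) (simp add: matching_def)
  moreover have "corner_colours n T3 (SG_b n \<in> S1) (SG_b n \<in> S2) r"
    unfolding corner_colours_def using S g s(4) by (intro bexI[OF _ s(3)]) (simp add: matching_def)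
  ultimately show ?R by blast
next
  assume ?R
  then obtain x y c where xyc: "corner_colours n T1 p x y" "corner_colours n T2 x q c"
    "corner_colours n T3 y c r" by blast
  obtain S1 where S1: "S1 \<in> closed_sets (SG_verts n) T1"
    "(0, 0) \<in> S1 \<longleftrightarrow> p" "SG_a n \<in> S1 \<longleftrightarrow> x" "SG_b n \<in> S1 \<longleftrightarrow> y"
    using xyc(1) unfolding corner_colours_def by blast
  obtain S2 where S2: "S2 \<in> closed_sets (SG_verts n) T2"
    "(0, 0) \<in> S2 \<longleftrightarrow> x" "SG_a n \<in> S2 \<longleftrightarrow> q" "SG_b n \<in> S2 \<longleftrightarrow> c"
    using xyc(2) unfolding corner_colours_def by blast
  obtain S3 where S3: "S3 \<in> closed_sets (SG_verts n) T3"
    "(0, 0) \<in> S3 \<longleftrightarrow> y" "SG_a n \<in> S3 \<longleftrightarrow> c" "SG_b n \<in> S3 \<longleftrightarrow> r"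
    using xyc(3) unfolding corner_colours_def by blast
  have m: "matching n S1 S2 S3" using S1 S2 S3 by (simp add: matching_def)
  note g = glue_corners[OF S1(1) S2(1) S3(1) m]
  have "glue_verts n S1 S2 S3 \<in> closed_sets (SG_verts (Suc n)) (glue_edges n T1 T2 T3)"
    unfolding closed_sets_glue[OF T] using S1(1) S2(1) S3(1) m by blast
  then show ?L
    unfolding corner_colours_def using S1 S2 S3 g by (intro bexI[of _ "glue_verts n S1 S2 S3"]) simp_all
qed

text \<open>A component without an outmost vertex either stays inside one copy and avoids its
  corners, which rootedness of the parts excludes, or it passes through a_n, b_n or c_n, which the
  last condition excludes.\<close>

lemma rooted_glue:
  assumes T: "T1 \<subseteq> SG_edges n" "T2 \<subseteq> SG_edges n" "T3 \<subseteq> SG_edges n"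
  shows "rooted (Suc n) (glue_edges n T1 T2 T3) \<longleftrightarrow>
    rooted n T1 \<and> rooted n T2 \<and> rooted n T3 \<and>
    (\<forall>x y c. corner_colours n T1 False x y \<longrightarrow> corner_colours n T2 x False c \<longrightarrow>
       corner_colours n T3 y c False \<longrightarrow> \<not> x \<and> \<not> y \<and> \<not> c)" (is "?L \<longleftrightarrow> ?R")
proof
  assume L: ?L
  have main: "S1 = {} \<and> S2 = {} \<and> S3 = {}"
    if s: "S1 \<in> closed_sets (SG_verts n) T1" "S2 \<in> closed_sets (SG_verts n) T2"
      "S3 \<in> closed_sets (SG_verts n) T3" "matching n S1 S2 S3"
      "(0, 0) \<notin> S1" "SG_a n \<notin> S2" "SG_b n \<notin> S3" for S1 S2 S3
  proof -
    note g = glue_corners[OF s(1-4)]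
    have "glue_verts n S1 S2 S3 \<in> closed_sets (SG_verts (Suc n)) (glue_edges n T1 T2 T3)"
      unfolding closed_sets_glue[OF T] using s by blast
    then have "glue_verts n S1 S2 S3 = {}" using L s g unfolding rooted_def by blast
    then show ?thesis unfolding glue_verts_def by blast
  qed
  \<comment> \<open>A closed set that avoids the corners of its own copy matches empty sets in the
    other two copies.\<close>
  note none = empty_in_closed_sets
  have "rooted n T1" unfolding rooted_def
    using main[OF _ none none] by (auto simp: matching_def)
  moreover have "rooted n T2" unfolding rooted_def
    using main[OF none _ none] by (auto simp: matching_def)
  moreover have "rooted n T3" unfolding rooted_def
    using main[OF none none] by (auto simp: matching_def)
  moreover have "\<not> x \<and> \<not> y \<and> \<not> c"
    if xyc: "corner_colours n T1 False x y" "corner_colours n T2 x False c" "corner_colours n T3 y c False" for x y c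
  proof -
    obtain S1 where S1: "S1 \<in> closed_sets (SG_verts n) T1"
      "(0, 0) \<notin> S1" "SG_a n \<in> S1 \<longleftrightarrow> x" "SG_b n \<in> S1 \<longleftrightarrow> y"
      using xyc(1) unfolding corner_colours_def by blast
    obtain S2 where S2: "S2 \<in> closed_sets (SG_verts n) T2"
      "(0, 0) \<in> S2 \<longleftrightarrow> x" "SG_a n \<notin> S2" "SG_b n \<in> S2 \<longleftrightarrow> c"
      using xyc(2) unfolding corner_colours_def by blast
    obtain S3 where S3: "S3 \<in> closed_sets (SG_verts n) T3"
      "(0, 0) \<in> S3 \<longleftrightarrow> y" "SG_a n \<in> S3 \<longleftrightarrow> c" "SG_b n \<notin> S3"
      using xyc(3) unfolding corner_colours_def by blast
    have "matching n S1 S2 S3" using S1 S2 S3 by (simp add: matching_def)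
    then have "S1 = {} \<and> S2 = {} \<and> S3 = {}" using S1 S2 S3 by (intro main)
    then show ?thesis using S1 S2 S3 by simp
  qed
  ultimately show ?R by blast
next
  assume R: ?R
  show ?L unfolding rooted_def
  proof (intro ballI impI)
    fix S assume S: "S \<in> closed_sets (SG_verts (Suc n)) (glue_edges n T1 T2 T3)"
      "(0, 0) \<notin> S" "SG_a (Suc n) \<notin> S" "SG_b (Suc n) \<notin> S"
    obtain S1 S2 S3 where s: "S1 \<in> closed_sets (SG_verts n) T1" "S2 \<in> closed_sets (SG_verts n) T2"
      "S3 \<in> closed_sets (SG_verts n) T3" "matching n S1 S2 S3" "S = glue_verts n S1 S2 S3"
      using S(1) unfolding closed_sets_glue[OF T] by blast
    note g = glue_corners[OF s(1-4), folded s(5)]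
    have "corner_colours n T1 False (SG_a n \<in> S1) (SG_b n \<in> S1)"
      unfolding corner_colours_def using S g by (intro bexI[OF _ s(1)]) simp
    moreover have "corner_colours n T2 (SG_a n \<in> S1) False (SG_b n \<in> S2)"
      unfolding corner_colours_def using S g s(4) by (intro bexI[OF _ s(2)]) (simp add: matching_def)
    moreover have "corner_colours n T3 (SG_b n \<in> S1) (SG_b n \<in> S2) False"
      unfolding corner_colours_def using S g s(4) by (intro bexI[OF _ s(3)]) (simp add: matching_def)
    ultimately have "SG_a n \<notin> S1" "SG_b n \<notin> S1" "SG_b n \<notin> S2" using R by blast+
    then have "S1 = {}" "S2 = {}" "S3 = {}"
      using R s(1-4) S(2-4) g unfolding rooted_def matching_def by metis+
    then show "S = {}" unfolding s(5) glue_verts_def by simp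
  qed
qed

text \<open>The vertices a_n, b_n and c_n belong to two copies each.\<close>

lemma card_SG_verts_Suc: "card (SG_verts (Suc n)) + 3 = 3 * card (SG_verts n)"
proof -
  let ?V = "SG_verts n"
  have fin: "finite ?V" "finite (shift_a n ` ?V)" "finite (shift_b n ` ?V)" by (simp_all add: finite_SG_verts)
  have c: "card (shift_a n ` ?V) = card ?V" "card (shift_b n ` ?V) = card ?V"
    by (simp_all add: card_image inj_on_def)
  have 1: "card ?V + card ?V = card (?V \<union> shift_a n ` ?V) + 1"
    using card_Un_Int[OF fin(1,2)] by (simp add: c SG_verts_lower_copies)
  have "(?V \<union> shift_a n ` ?V) \<inter> shift_b n ` ?V = {SG_b n, SG_c n}"
    unfolding Int_Un_distrib2 SG_verts_left_copies SG_verts_upper_copies by blast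
  then have "card ((?V \<union> shift_a n ` ?V) \<inter> shift_b n ` ?V) = 2" by (simp add: SG_b_def SG_c_def)
  then have "card (?V \<union> shift_a n ` ?V) + card ?V = card (SG_verts (Suc n)) + 2"
    using card_Un_Int[of "?V \<union> shift_a n ` ?V" "shift_b n ` ?V"] fin by (simp add: c)
  then show ?thesis using 1 by simp
qed

text \<open>Two copies share a single vertex, whereas an edge has two.\<close>

lemma SG_edges_disjoint:
  assumes "d \<in> SG_edges n" "e \<in> SG_edges n"
  shows "d \<noteq> shift_a n ` e" "d \<noteq> shift_b n ` e" "shift_a n ` d \<noteq> shift_b n ` e"
proof -
  note de = SG_edges_subset[OF assms(1)] SG_edges_subset[OF assms(2)]
  have *: "X \<noteq> Y" if "card X = 2" "X \<subseteq> A" "Y \<subseteq> B" "A \<inter> B = {z}" for X Y A B :: "(nat \<times> nat) set" and z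
  proof
    assume "X = Y"
    then have "X \<subseteq> {z}" using that by blast
    then show False using that(1) card_mono[of "{z}" X] by simp
  qed
  have "card (shift_a n ` d) = 2" using de by (simp add: card_image inj_on_def)
  then show "d \<noteq> shift_a n ` e" "d \<noteq> shift_b n ` e" "shift_a n ` d \<noteq> shift_b n ` e"
    using de *[of d "SG_verts n" "shift_a n ` e" "shift_a n ` SG_verts n", OF _ _ _ SG_verts_lower_copies]
      *[of d "SG_verts n" "shift_b n ` e" "shift_b n ` SG_verts n", OF _ _ _ SG_verts_left_copies]
      *[of "shift_a n ` d" "shift_a n ` SG_verts n" "shift_b n ` e" "shift_b n ` SG_verts n",
          OF _ _ _ SG_verts_upper_copies] by (simp_all add: image_mono)
qed

lemma inj_image_shift: "inj (image (shift_a n))" "inj (image (shift_b n))"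
proof -
  have i: "inj (shift_a n)" "inj (shift_b n)" by (rule injI, simp)+
  show "inj (image (shift_a n))" "inj (image (shift_b n))"
    by (rule injI, simp only: inj_image_eq_iff[OF i(1)], rule injI, simp only: inj_image_eq_iff[OF i(2)])
qed

text \<open>The predicate \<open>P\<close> serves two purposes: with \<open>P\<close> constantly
  true it gives the size of the edge set, with incidence to a vertex it gives the degree.\<close>

lemma card_filter_glue_edges:
  assumes T: "T1 \<subseteq> SG_edges n" "T2 \<subseteq> SG_edges n" "T3 \<subseteq> SG_edges n"
  shows "card {e \<in> glue_edges n T1 T2 T3. P e} =
    card {e \<in> T1. P e} + card {e \<in> T2. P (shift_a n ` e)} + card {e \<in> T3. P (shift_b n ` e)}"
proof -
  let ?A = "{e \<in> T1. P e}" and ?B = "{e \<in> T2. P (shift_a n ` e)}" and ?C = "{e \<in> T3. P (shift_b n ` e)}"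
  have fin: "finite T1" "finite T2" "finite T3" using T finite_SG_edges finite_subset by blast+
  have eq: "{e \<in> glue_edges n T1 T2 T3. P e} = ?A \<union> image (shift_a n) ` ?B \<union> image (shift_b n) ` ?C"
    unfolding glue_edges_def by blast
  have disj: "?A \<inter> image (shift_a n) ` ?B = {}"
    "(?A \<union> image (shift_a n) ` ?B) \<inter> image (shift_b n) ` ?C = {}"
  proof -
    have "e \<noteq> shift_a n ` d" if "e \<in> T1" "d \<in> T2" for d e
      using that T SG_edges_disjoint(1)[of e n d] by blast
    then show "?A \<inter> image (shift_a n) ` ?B = {}" by blast
    have "e \<noteq> shift_b n ` d" if "e \<in> T1" "d \<in> T3" for d e
      using that T SG_edges_disjoint(2)[of e n d] by blast
    moreover have "shift_a n ` e \<noteq> shift_b n ` d" if "e \<in> T2" "d \<in> T3" for d e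
      using that T SG_edges_disjoint(3)[of e n d] by blast
    ultimately show "(?A \<union> image (shift_a n) ` ?B) \<inter> image (shift_b n) ` ?C = {}" by blast
  qed
  have "card (?A \<union> image (shift_a n) ` ?B \<union> image (shift_b n) ` ?C) =
      card (?A \<union> image (shift_a n) ` ?B) + card (image (shift_b n) ` ?C)"
    using fin by (intro card_Un_disjoint disj) simp_all
  also have "card (?A \<union> image (shift_a n) ` ?B) = card ?A + card (image (shift_a n) ` ?B)"
    using fin by (intro card_Un_disjoint disj) simp_all
  also have "card (image (shift_a n) ` ?B) = card ?B"
    by (rule card_image) (rule inj_on_subset[OF inj_image_shift(1)], simp)
  also have "card (image (shift_b n) ` ?C) = card ?C"
    by (rule card_image) (rule inj_on_subset[OF inj_image_shift(2)], simp)
  finally show ?thesis unfolding eq .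
qed

lemma card_glue_edges:
  assumes T: "T1 \<subseteq> SG_edges n" "T2 \<subseteq> SG_edges n" "T3 \<subseteq> SG_edges n"
  shows "card (glue_edges n T1 T2 T3) = card T1 + card T2 + card T3"
  using card_filter_glue_edges[OF assms, of "\<lambda>_. True"] by simp

lemma glue_edges_inject:
  assumes T: "T1 \<subseteq> SG_edges n" "T2 \<subseteq> SG_edges n" "T3 \<subseteq> SG_edges n"
    and U: "U1 \<subseteq> SG_edges n" "U2 \<subseteq> SG_edges n" "U3 \<subseteq> SG_edges n"
    and eq: "glue_edges n T1 T2 T3 = glue_edges n U1 U2 U3"
  shows "T1 = U1 \<and> T2 = U2 \<and> T3 = U3"
proof -
  have parts: "X1 = glue_edges n X1 X2 X3 \<inter> SG_edges n \<and>
      X2 = {e \<in> SG_edges n. shift_a n ` e \<in> glue_edges n X1 X2 X3} \<and>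
      X3 = {e \<in> SG_edges n. shift_b n ` e \<in> glue_edges n X1 X2 X3}"
    if X: "X1 \<subseteq> SG_edges n" "X2 \<subseteq> SG_edges n" "X3 \<subseteq> SG_edges n" for X1 X2 X3
  proof -
    have mem: "e \<in> glue_edges n X1 X2 X3 \<longleftrightarrow>
        e \<in> X1 \<or> (\<exists>d\<in>X2. e = shift_a n ` d) \<or> (\<exists>d\<in>X3. e = shift_b n ` d)" for e
      unfolding glue_edges_def by blast
    have inj: "shift_a n ` d = shift_a n ` e \<longleftrightarrow> d = e" "shift_b n ` d = shift_b n ` e \<longleftrightarrow> d = e" for d e
      using inj_image_shift[of n] by (simp_all add: inj_eq)
    have "e \<in> glue_edges n X1 X2 X3 \<longleftrightarrow> e \<in> X1" "shift_a n ` e \<in> glue_edges n X1 X2 X3 \<longleftrightarrow> e \<in> X2"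
      "shift_b n ` e \<in> glue_edges n X1 X2 X3 \<longleftrightarrow> e \<in> X3" if "e \<in> SG_edges n" for e
      unfolding mem inj using that X SG_edges_disjoint by (metis subsetD)+
    then show ?thesis using X by blast
  qed
  show ?thesis using parts[OF T] parts[OF U] eq by metis
qed

lemma subset_glue_edges:
  assumes "T \<subseteq> SG_edges (Suc n)"
  obtains T1 T2 T3 where "T1 \<subseteq> SG_edges n" "T2 \<subseteq> SG_edges n" "T3 \<subseteq> SG_edges n"
    "T = glue_edges n T1 T2 T3"
proof -
  have "T = glue_edges n (T \<inter> SG_edges n) {e \<in> SG_edges n. shift_a n ` e \<in> T} {e \<in> SG_edges n. shift_b n ` e \<in> T}"
    using assms unfolding glue_edges_def SG_edges.simps by blast
  then show thesis by (intro that[of "T \<inter> SG_edges n"]) auto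
qed

text \<open>The truth-table form of \<open>corner_colours_glue\<close> and
  \<open>rooted_glue\<close>: since it mentions types only, it can be evaluated by running through
  Boolean values.\<close>

definition glues :: "corner_type \<Rightarrow> corner_type \<Rightarrow> corner_type \<Rightarrow> corner_type \<Rightarrow> bool" where
  "glues t t1 t2 t3 \<longleftrightarrow>
     (\<forall>p q r. admits t p q r \<longleftrightarrow> (\<exists>x y c. admits t1 p x y \<and> admits t2 x q c \<and> admits t3 y c r)) \<and>
     (\<forall>x y c. admits t1 False x y \<longrightarrow> admits t2 x False c \<longrightarrow> admits t3 y c False \<longrightarrow> \<not> x \<and> \<not> y \<and> \<not> c)"

text \<open>Identifying three pairs of vertices merges components at most three times; equality
  means that no cycle closes across the copies. The finitely many types are checked one by
  one.\<close>

lemma glues_blocks_le: "glues t t1 t2 t3 \<Longrightarrow> blocks t1 + blocks t2 + blocks t3 \<le> blocks t + 3"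
  unfolding glues_def
  by (cases t; cases t1; cases t2; cases t3; simp add: all_bool_eq ex_bool_eq)

text \<open>
  Acyclicity is hidden in the cardinality: by \<open>card_SG_verts_le\<close> a rooted edge set of type \<open>t\<close> has at
  least \<open>card (SG_verts n) - blocks t\<close> edges, and a cycle would cost one more.
\<close>

definition forests :: "nat \<Rightarrow> corner_type \<Rightarrow> (nat \<times> nat) set set set" where
  "forests n t = {T. T \<subseteq> SG_edges n \<and> rooted n T \<and> corner_colours n T = admits t \<and>
     card T + blocks t = card (SG_verts n)}"

lemma finite_forests: "finite (forests n t)"
  by (rule finite_subset[of _ "Pow (SG_edges n)"]) (auto simp: forests_def finite_SG_edges)

text \<open>Edge counts add, and so do vertex counts up to the constant 3. The bounds of
  \<open>card_SG_verts_le\<close> for the three parts and \<open>glues_blocks_le\<close> point in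
  the same direction, so the equality required of the whole forces equality in each of them.\<close>

lemma glue_edges_in_forests:
  assumes T: "T1 \<subseteq> SG_edges n" "T2 \<subseteq> SG_edges n" "T3 \<subseteq> SG_edges n"
  shows "glue_edges n T1 T2 T3 \<in> forests (Suc n) t \<longleftrightarrow>
    (\<exists>t1 t2 t3. glues t t1 t2 t3 \<and> blocks t1 + blocks t2 + blocks t3 = blocks t + 3 \<and>
       T1 \<in> forests n t1 \<and> T2 \<in> forests n t2 \<and> T3 \<in> forests n t3)" (is "?L \<longleftrightarrow> ?R")
proof -
  obtain t1 t2 t3 where t: "corner_colours n T1 = admits t1" "corner_colours n T2 = admits t2"
    "corner_colours n T3 = admits t3" using ex_corner_type T by metis
  have sub: "glue_edges n T1 T2 T3 \<subseteq> SG_edges (Suc n)"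
    using T unfolding glue_edges_def SG_edges.simps by blast
  have g: "rooted (Suc n) (glue_edges n T1 T2 T3) \<and> corner_colours (Suc n) (glue_edges n T1 T2 T3) = admits t
    \<longleftrightarrow> rooted n T1 \<and> rooted n T2 \<and> rooted n T3 \<and> glues t t1 t2 t3"
    unfolding rooted_glue[OF T] fun_eq_iff corner_colours_glue[OF T] t glues_def by blast
  have c: "card (glue_edges n T1 T2 T3) = card T1 + card T2 + card T3" by (rule card_glue_edges[OF T])
  show ?thesis
  proof
    assume ?L
    then have L: "rooted n T1" "rooted n T2" "rooted n T3" "glues t t1 t2 t3"
      "card T1 + card T2 + card T3 + blocks t = card (SG_verts (Suc n))"
      using g by (auto simp: forests_def c)
    have "card (SG_verts n) \<le> card T1 + blocks t1" "card (SG_verts n) \<le> card T2 + blocks t2"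
      "card (SG_verts n) \<le> card T3 + blocks t3" using card_SG_verts_le T t L by blast+
    then have "card T1 + blocks t1 = card (SG_verts n)" "card T2 + blocks t2 = card (SG_verts n)"
      "card T3 + blocks t3 = card (SG_verts n)" "blocks t1 + blocks t2 + blocks t3 = blocks t + 3"
      using glues_blocks_le[OF L(4)] L(5) card_SG_verts_Suc[of n] by linarith+
    then show ?R using T t L by (auto simp: forests_def)
  next
    assume ?R
    then obtain u1 u2 u3 where u: "glues t u1 u2 u3" "blocks u1 + blocks u2 + blocks u3 = blocks t + 3"
      "T1 \<in> forests n u1" "T2 \<in> forests n u2" "T3 \<in> forests n u3" by blast
    then have "u1 = t1" "u2 = t2" "u3 = t3" using t by (auto simp: forests_def intro!: inj_admits)
    with u show ?L using g c sub card_SG_verts_Suc[of n] by (auto simp: forests_def)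
  qed
qed

lemma forests_unique: "T \<in> forests n t \<Longrightarrow> T \<in> forests n t' \<Longrightarrow> t = t'"
  by (rule inj_admits) (simp add: forests_def)

definition forest_sum :: "nat \<Rightarrow> ((nat \<times> nat) set set \<Rightarrow> real) \<Rightarrow> corner_type \<Rightarrow> real" where
  "forest_sum n w t = (\<Sum>T\<in>forests n t. w T)"

definition gluings :: "corner_type \<Rightarrow> (corner_type \<times> corner_type \<times> corner_type) set" where
  "gluings t = {(t1, t2, t3). glues t t1 t2 t3 \<and> blocks t1 + blocks t2 + blocks t3 = blocks t + 3}"

definition glue_sums ::
    "(corner_type \<Rightarrow> real) \<Rightarrow> (corner_type \<Rightarrow> real) \<Rightarrow> (corner_type \<Rightarrow> real) \<Rightarrow> corner_type \<Rightarrow> real" where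
  "glue_sums f g h t = (\<Sum>(t1, t2, t3)\<in>gluings t. f t1 * g t2 * h t3)"

text \<open>Gluing is a bijection from triples of forests with compatible types. The three weights
  are kept apart because a marked vertex lies in one or two copies only; the others then carry the
  weight 1.\<close>

lemma forest_sum_Suc:
  assumes w: "\<And>T1 T2 T3. T1 \<subseteq> SG_edges n \<Longrightarrow> T2 \<subseteq> SG_edges n \<Longrightarrow> T3 \<subseteq> SG_edges n \<Longrightarrow>
    w (glue_edges n T1 T2 T3) = w1 T1 * w2 T2 * w3 T3"
  shows "forest_sum (Suc n) w = glue_sums (forest_sum n w1) (forest_sum n w2) (forest_sum n w3)"
proof
  fix t
  let ?F = "forests n"
  let ?X = "\<lambda>(t1, t2, t3). ?F t1 \<times> ?F t2 \<times> ?F t3"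
  let ?g = "\<lambda>(T1, T2, T3). glue_edges n T1 T2 T3"
  have sub: "T \<subseteq> SG_edges n" if "T \<in> ?F u" for T u using that by (simp add: forests_def)
  have "forests (Suc n) t = ?g ` (\<Union>k\<in>gluings t. ?X k)"
  proof (intro equalityI subsetI)
    fix T assume T: "T \<in> forests (Suc n) t"
    then have "T \<subseteq> SG_edges (Suc n)" by (simp add: forests_def)
    then obtain T1 T2 T3 where *: "T1 \<subseteq> SG_edges n" "T2 \<subseteq> SG_edges n" "T3 \<subseteq> SG_edges n"
      "T = glue_edges n T1 T2 T3" by (rule subset_glue_edges)
    obtain t1 t2 t3 where "glues t t1 t2 t3" "blocks t1 + blocks t2 + blocks t3 = blocks t + 3"
       "T1 \<in> ?F t1" "T2 \<in> ?F t2" "T3 \<in> ?F t3"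
      using T unfolding *(4) glue_edges_in_forests[OF *(1-3)] by blast
    then have "(T1, T2, T3) \<in> (\<Union>k\<in>gluings t. ?X k)" unfolding gluings_def by blast
    then show "T \<in> ?g ` (\<Union>k\<in>gluings t. ?X k)" unfolding *(4) by (rule rev_image_eqI) simp
  next
    fix T assume "T \<in> ?g ` (\<Union>k\<in>gluings t. ?X k)"
    then obtain t1 t2 t3 T1 T2 T3 where *: "(t1, t2, t3) \<in> gluings t" "T1 \<in> ?F t1" "T2 \<in> ?F t2" "T3 \<in> ?F t3"
      "T = glue_edges n T1 T2 T3" by auto
    then show "T \<in> forests (Suc n) t"
      unfolding *(5) glue_edges_in_forests[OF *(2-4)[THEN sub]] gluings_def by blast
  qed
  moreover have "inj_on ?g (\<Union>k\<in>gluings t. ?X k)"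
  proof (rule inj_onI)
    fix K K' assume K: "K \<in> (\<Union>k\<in>gluings t. ?X k)" "K' \<in> (\<Union>k\<in>gluings t. ?X k)" "?g K = ?g K'"
    obtain T1 T2 T3 U1 U2 U3 where TU: "K = (T1, T2, T3)" "K' = (U1, U2, U3)" by (metis prod_cases3)
    have "T1 \<subseteq> SG_edges n" "T2 \<subseteq> SG_edges n" "T3 \<subseteq> SG_edges n"
      "U1 \<subseteq> SG_edges n" "U2 \<subseteq> SG_edges n" "U3 \<subseteq> SG_edges n"
      using K(1,2) unfolding TU by (auto dest: sub)
    then show "K = K'" using glue_edges_inject[of T1 n T2 T3 U1 U2 U3] K(3) unfolding TU by simp
  qed
  ultimately have "forest_sum (Suc n) w t = (\<Sum>K\<in>(\<Union>k\<in>gluings t. ?X k). w (?g K))"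
    unfolding forest_sum_def by (simp add: sum.reindex)
  also have "\<dots> = (\<Sum>k\<in>gluings t. \<Sum>K\<in>?X k. w (?g K))"
  proof (rule sum.UNION_disjoint)
    show "finite (gluings t)" by (rule finite_subset[OF subset_UNIV]) simp
    show "\<forall>k\<in>gluings t. finite (?X k)" by (auto simp: finite_forests)
    show "\<forall>k\<in>gluings t. \<forall>k'\<in>gluings t. k \<noteq> k' \<longrightarrow> ?X k \<inter> ?X k' = {}"
    proof (intro ballI impI equals0I)
      fix k k' K assume k: "k \<noteq> k'" and K: "K \<in> ?X k \<inter> ?X k'"
      obtain t1 t2 t3 u1 u2 u3 where tu: "k = (t1, t2, t3)" "k' = (u1, u2, u3)" by (metis prod_cases3)
      have "t1 = u1" "t2 = u2" "t3 = u3" using K unfolding tu by (auto intro: forests_unique)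
      then show False using k unfolding tu by simp
    qed
  qed
  also have "\<dots> = (\<Sum>(t1, t2, t3)\<in>gluings t. forest_sum n w1 t1 * forest_sum n w2 t2 * forest_sum n w3 t3)"
  proof (rule sum.cong[OF refl])
    fix k
    obtain t1 t2 t3 :: corner_type where k: "k = (t1, t2, t3)" by (metis prod_cases3)
    have "(\<Sum>K\<in>?X (t1, t2, t3). w (?g K)) = (\<Sum>(T1, T2, T3)\<in>?F t1 \<times> ?F t2 \<times> ?F t3. w1 T1 * (w2 T2 * w3 T3))"
      by (rule sum.cong) (auto simp: w sub)
    also have "\<dots> = forest_sum n w1 t1 * (forest_sum n w2 t2 * forest_sum n w3 t3)"
      unfolding forest_sum_def sum_product sum.cartesian_product by (simp add: case_prod_unfold)
    finally show "(\<Sum>K\<in>?X k. w (?g K)) =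
        (case k of (t1, t2, t3) \<Rightarrow> forest_sum n w1 t1 * forest_sum n w2 t2 * forest_sum n w3 t3)"
      by (simp add: k mult.assoc)
  qed
  finally show "forest_sum (Suc n) w t = glue_sums (forest_sum n w1) (forest_sum n w2) (forest_sum n w3) t"
    unfolding glue_sums_def .
qed

text \<open>Summing over all triples of types, with the condition moved into the summand, lets
  simplification decide \<open>glues\<close> triple by triple.\<close>

lemma glue_sums_UNIV:
  "glue_sums f g h t = (\<Sum>t1\<in>UNIV. \<Sum>t2\<in>UNIV. \<Sum>t3\<in>UNIV.
     if glues t t1 t2 t3 \<and> blocks t1 + blocks t2 + blocks t3 = blocks t + 3 then f t1 * g t2 * h t3 else 0)"
proof -
  have "glue_sums f g h t = (\<Sum>(t1, t2, t3)\<in>UNIV \<times> UNIV \<times> UNIV.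
     if glues t t1 t2 t3 \<and> blocks t1 + blocks t2 + blocks t3 = blocks t + 3 then f t1 * g t2 * h t3 else 0)"
    unfolding glue_sums_def by (rule sum.mono_neutral_cong_left) (auto simp: gluings_def split: if_splits)
  then show ?thesis by (simp add: sum.cartesian_product)
qed

section \<open>The recursion and degrees\<close>

text \<open>The copies form a ring of three. A spanning tree restricts to spanning trees of two
  copies and to a two-component forest of the third that separates the two corners shared with the
  others.\<close>

lemma glue_sums_Joined:
  "glue_sums f g h Joined = f Joined * g Joined * (h Join_ob + h Join_ab)
     + f Joined * (g Join_oa + g Join_ab) * h Joined + (f Join_oa + f Join_ob) * g Joined * h Joined"
  unfolding glue_sums_UNIV UNIV_corner_type
  by (simp add: glues_def all_bool_eq ex_bool_eq algebra_simps)

lemma glue_sums_Join_oa: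
  "glue_sums f g h Join_oa = f Joined * g Joined * h Separate + f Joined * g Join_oa * (h Join_oa + h Join_ab)
     + f Joined * g Join_ab * h Join_oa + f Join_oa * g Joined * (h Join_oa + h Join_ob)
     + f Join_oa * g Join_oa * h Joined + f Join_ob * g Joined * h Join_oa"
  unfolding glue_sums_UNIV UNIV_corner_type
  by (simp add: glues_def all_bool_eq ex_bool_eq algebra_simps)

lemma glue_sums_Join_ob:
  "glue_sums f g h Join_ob = f Joined * g Separate * h Joined + f Joined * g Join_ob * (h Join_ob + h Join_ab)
     + f Joined * g Join_ab * h Join_ob + f Join_oa * g Join_ob * h Joined
     + f Join_ob * (g Join_oa + g Join_ob) * h Joined + f Join_ob * g Joined * h Join_ob"
  unfolding glue_sums_UNIV UNIV_corner_type
  by (simp add: glues_def all_bool_eq ex_bool_eq algebra_simps)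

lemma glue_sums_Join_ab:
  "glue_sums f g h Join_ab = f Joined * g Join_ab * h Join_ab + f Join_oa * g Join_ab * h Joined
     + f Join_ob * g Joined * h Join_ab + f Join_ab * g Joined * (h Join_ob + h Join_ab)
     + f Join_ab * (g Join_oa + g Join_ab) * h Joined + f Separate * g Joined * h Joined"
  unfolding glue_sums_UNIV UNIV_corner_type
  by (simp add: glues_def all_bool_eq ex_bool_eq algebra_simps)

lemma glue_sums_Separate:
  "glue_sums f g h Separate =
     f Joined * (g Join_ob + g Join_ab) * h Separate + f Joined * g Separate * (h Join_oa + h Join_ab)
     + f Join_oa * ((g Join_ob + g Join_ab) * (h Join_oa + h Join_ob) + g Separate * h Joined)
     + f Join_ob * (g Joined * h Separate + (g Join_oa + g Join_ob) * (h Join_oa + h Join_ab))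
     + f Join_ab * (g Joined * h Separate + g Join_oa * (h Join_oa + h Join_ab)
         + g Join_ob * (h Join_ob + h Join_ab) + g Join_ab * (h Join_oa + h Join_ob) + g Separate * h Joined)
     + f Separate * (g Joined * (h Join_oa + h Join_ob) + (g Join_oa + g Join_ob) * h Joined)"
  unfolding glue_sums_UNIV UNIV_corner_type
  by (simp add: glues_def all_bool_eq ex_bool_eq algebra_simps)

abbreviation edge_oa :: "(nat \<times> nat) set" where "edge_oa \<equiv> {(0, 0), (1, 0)}"
abbreviation edge_ob :: "(nat \<times> nat) set" where "edge_ob \<equiv> {(0, 0), (0, 1)}"
abbreviation edge_ab :: "(nat \<times> nat) set" where "edge_ab \<equiv> {(1, 0), (0, 1)}"

section \<open>The triangle \<open>SG(0)\<close>\<close>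

lemma corner_colours_0:
  assumes "T \<subseteq> SG_edges 0"
  shows "corner_colours 0 T p q r \<longleftrightarrow>
    (edge_oa \<in> T \<longrightarrow> p = q) \<and> (edge_ob \<in> T \<longrightarrow> p = r) \<and> (edge_ab \<in> T \<longrightarrow> q = r)"
    (is "_ \<longleftrightarrow> ?R")
proof
  assume "corner_colours 0 T p q r"
  then obtain S where S: "S \<in> closed_sets (SG_verts 0) T"
    "(0, 0) \<in> S \<longleftrightarrow> p" "(1, 0) \<in> S \<longleftrightarrow> q" "(0, 1) \<in> S \<longleftrightarrow> r"
    unfolding corner_colours_def by (auto simp: SG_a_def SG_b_def)
  then have "e \<subseteq> S \<or> e \<inter> S = {}" if "e \<in> T" for e using that by (auto simp: closed_sets_def)
  from this[of edge_oa] this[of edge_ob] this[of edge_ab] S(2-) show ?R by auto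
next
  assume R: ?R
  let ?S = "(if p then {(0, 0)} else {}) \<union> (if q then {(1, 0)} else {}) \<union>
    (if r then {(0, 1)} else {}) :: (nat \<times> nat) set"
  have "e \<subseteq> ?S \<or> e \<inter> ?S = {}" if "e \<in> T" for e
  proof -
    have "e = edge_oa \<or> e = edge_ob \<or> e = edge_ab" using assms that by auto
    then show ?thesis using R that by (elim disjE) auto
  qed
  then have "?S \<in> closed_sets (SG_verts 0) T" by (auto simp: closed_sets_def)
  then show "corner_colours 0 T p q r"
    unfolding corner_colours_def by (rule bexI[rotated]) (simp add: SG_a_def SG_b_def)
qed

lemma forests_0_iff:
  "T \<in> forests 0 t \<longleftrightarrow> T \<subseteq> SG_edges 0 \<and> card T + blocks t = 3 \<and>
    (\<forall>p q r. (edge_oa \<in> T \<longrightarrow> p = q) \<and> (edge_ob \<in> T \<longrightarrow> p = r) \<and> (edge_ab \<in> T \<longrightarrow> q = r) \<longleftrightarrow> admits t p q r)"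
proof -
  have col: "corner_colours 0 T = admits t \<longleftrightarrow> (\<forall>p q r.
      (edge_oa \<in> T \<longrightarrow> p = q) \<and> (edge_ob \<in> T \<longrightarrow> p = r) \<and> (edge_ab \<in> T \<longrightarrow> q = r) \<longleftrightarrow> admits t p q r)"
    if "T \<subseteq> SG_edges 0" using that by (simp only: fun_eq_iff corner_colours_0)
  \<comment> \<open>Every vertex of the triangle is a corner.\<close>
  have "rooted 0 T"
    unfolding rooted_def closed_sets_def by (auto simp: SG_a_def SG_b_def)
  moreover have "card (SG_verts 0) = 3" by simp
  ultimately have "T \<in> forests 0 t \<longleftrightarrow> T \<subseteq> SG_edges 0 \<and> corner_colours 0 T = admits t \<and> card T + blocks t = 3"
    by (simp only: forests_def mem_Collect_eq simp_thms)
  also have "\<dots> \<longleftrightarrow> T \<subseteq> SG_edges 0 \<and> card T + blocks t = 3 \<and> corner_colours 0 T = admits t"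
    by (simp only: conj_commute)
  finally show ?thesis by (simp only: col cong: conj_cong)
qed

text \<open>The edges are replaced by three abstract distinct elements, so that the case analysis
  concerns membership alone and never compares sets of lattice points.\<close>

lemma triangle_forest_iff:
  assumes d: "x \<noteq> y" "x \<noteq> z" "y \<noteq> z"
  shows "T \<subseteq> {x, y, z} \<and> card T + blocks t = 3 \<and>
      (\<forall>p q r. (x \<in> T \<longrightarrow> p = q) \<and> (y \<in> T \<longrightarrow> p = r) \<and> (z \<in> T \<longrightarrow> q = r) \<longleftrightarrow> admits t p q r) \<longleftrightarrow>
    T \<in> (case t of Joined \<Rightarrow> {{x, y}, {x, z}, {y, z}} | Join_oa \<Rightarrow> {{x}} | Join_ob \<Rightarrow> {{y}}
      | Join_ab \<Rightarrow> {{z}} | Separate \<Rightarrow> {{}})"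
proof (cases "T \<subseteq> {x, y, z}")
  case True
  then have "card T = card (T \<inter> {x, y, z})" by (simp add: Int_absorb2)
  also have "\<dots> = of_bool (x \<in> T) + of_bool (y \<in> T) + of_bool (z \<in> T)"
    using d by (simp add: Int_insert_right)
  finally have c: "card T = of_bool (x \<in> T) + of_bool (y \<in> T) + of_bool (z \<in> T)" .
  have eqs: "T = {x, y} \<longleftrightarrow> x \<in> T \<and> y \<in> T \<and> z \<notin> T" "T = {x, z} \<longleftrightarrow> x \<in> T \<and> y \<notin> T \<and> z \<in> T"
    "T = {y, z} \<longleftrightarrow> x \<notin> T \<and> y \<in> T \<and> z \<in> T" "T = {x} \<longleftrightarrow> x \<in> T \<and> y \<notin> T \<and> z \<notin> T"
    "T = {y} \<longleftrightarrow> x \<notin> T \<and> y \<in> T \<and> z \<notin> T" "T = {z} \<longleftrightarrow> x \<notin> T \<and> y \<notin> T \<and> z \<in> T"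
    "T = {} \<longleftrightarrow> x \<notin> T \<and> y \<notin> T \<and> z \<notin> T"
    using True d by blast+
  show ?thesis
    by (cases t; cases "x \<in> T"; cases "y \<in> T"; cases "z \<in> T")
      (simp_all add: c True eqs all_bool_eq)
next
  case False
  then show ?thesis by (cases t) auto
qed

lemma forests_0:
  "forests 0 Joined = {{edge_oa, edge_ob}, {edge_oa, edge_ab}, {edge_ob, edge_ab}}"
  "forests 0 Join_oa = {{edge_oa}}" "forests 0 Join_ob = {{edge_ob}}"
  "forests 0 Join_ab = {{edge_ab}}" "forests 0 Separate = {{}}"
proof -
  have d: "edge_oa \<noteq> edge_ob" "edge_oa \<noteq> edge_ab" "edge_ob \<noteq> edge_ab"
    by (simp_all add: doubleton_eq_iff)
  have "forests 0 t = (case t of Joined \<Rightarrow> {{edge_oa, edge_ob}, {edge_oa, edge_ab}, {edge_ob, edge_ab}}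
      | Join_oa \<Rightarrow> {{edge_oa}} | Join_ob \<Rightarrow> {{edge_ob}} | Join_ab \<Rightarrow> {{edge_ab}} | Separate \<Rightarrow> {{}})" for t
    unfolding set_eq_iff forests_0_iff SG_edges.simps(1) triangle_forest_iff[OF d] by blast
  from this[of Joined] this[of Join_oa] this[of Join_ob] this[of Join_ab] this[of Separate]
  show "forests 0 Joined = {{edge_oa, edge_ob}, {edge_oa, edge_ab}, {edge_ob, edge_ab}}"
    "forests 0 Join_oa = {{edge_oa}}" "forests 0 Join_ob = {{edge_ob}}"
    "forests 0 Join_ab = {{edge_ab}}" "forests 0 Separate = {{}}" by (simp_all only: corner_type.case)
qed

section \<open>Degrees in a glued edge set\<close>

definition degree :: "nat \<times> nat \<Rightarrow> (nat \<times> nat) set set \<Rightarrow> nat" where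
  "degree x T = card {e \<in> T. x \<in> e}"

lemma degree_glue_edges:
  assumes "T1 \<subseteq> SG_edges n" "T2 \<subseteq> SG_edges n" "T3 \<subseteq> SG_edges n"
  shows "degree x (glue_edges n T1 T2 T3) =
    degree x T1 + card {e \<in> T2. x \<in> shift_a n ` e} + card {e \<in> T3. x \<in> shift_b n ` e}"
  unfolding degree_def by (rule card_filter_glue_edges[OF assms])

lemma card_shift_filter:
  "card {e \<in> T. shift_a n y \<in> shift_a n ` e} = degree y T"
  "card {e \<in> T. shift_b n y \<in> shift_b n ` e} = degree y T"
proof -
  have i: "inj (shift_a n)" "inj (shift_b n)" by (rule injI, simp)+
  show "card {e \<in> T. shift_a n y \<in> shift_a n ` e} = degree y T"
    "card {e \<in> T. shift_b n y \<in> shift_b n ` e} = degree y T"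
    unfolding degree_def inj_image_mem_iff[OF i(1)] inj_image_mem_iff[OF i(2)] by (rule refl)+
qed

lemma degree_0: "T \<subseteq> SG_edges n \<Longrightarrow> x \<notin> SG_verts n \<Longrightarrow> degree x T = 0"
  unfolding degree_def using SG_edges_subset by (auto simp: card_eq_0_iff)

lemma card_shift_filter_0:
  assumes "T \<subseteq> SG_edges n"
  shows "x \<notin> shift_a n ` SG_verts n \<Longrightarrow> card {e \<in> T. x \<in> shift_a n ` e} = 0"
    "x \<notin> shift_b n ` SG_verts n \<Longrightarrow> card {e \<in> T. x \<in> shift_b n ` e} = 0"
proof -
  have sub: "e \<subseteq> SG_verts n" if "e \<in> T" for e using that assms SG_edges_subset by blast
  show "x \<notin> shift_a n ` SG_verts n \<Longrightarrow> card {e \<in> T. x \<in> shift_a n ` e} = 0"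
  proof -
    assume "x \<notin> shift_a n ` SG_verts n"
    then have "{e \<in> T. x \<in> shift_a n ` e} = {}" using sub by blast
    then show ?thesis by (simp only: card.empty)
  qed
  show "x \<notin> shift_b n ` SG_verts n \<Longrightarrow> card {e \<in> T. x \<in> shift_b n ` e} = 0"
  proof -
    assume "x \<notin> shift_b n ` SG_verts n"
    then have "{e \<in> T. x \<in> shift_b n ` e} = {}" using sub by blast
    then show ?thesis by (simp only: card.empty)
  qed
qed

lemma mem_shift_verts:
  "x \<in> SG_verts n \<Longrightarrow> x \<in> shift_a n ` SG_verts n \<longleftrightarrow> x = SG_a n"
  "x \<in> SG_verts n \<Longrightarrow> x \<in> shift_b n ` SG_verts n \<longleftrightarrow> x = SG_b n"
  using SG_verts_lower_copies[of n] SG_verts_left_copies[of n] by blast+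

text \<open>A copy contributes to the degree of a vertex only if it contains that vertex: two copies
  do at a_n and c_n, one in the other cases.\<close>

lemma degree_glue:
  assumes T: "T1 \<subseteq> SG_edges n" "T2 \<subseteq> SG_edges n" "T3 \<subseteq> SG_edges n"
  shows "x \<in> SG_verts n \<Longrightarrow> x \<noteq> SG_a n \<Longrightarrow> x \<noteq> SG_b n \<Longrightarrow>
      degree x (glue_edges n T1 T2 T3) = degree x T1"
    "degree (SG_a n) (glue_edges n T1 T2 T3) = degree (SG_a n) T1 + degree (0, 0) T2"
    "degree (SG_c n) (glue_edges n T1 T2 T3) = degree (SG_b n) T2 + degree (SG_a n) T3"
    "degree (SG_a (Suc n)) (glue_edges n T1 T2 T3) = degree (SG_a n) T2"
    "degree (SG_b (Suc n)) (glue_edges n T1 T2 T3) = degree (SG_b n) T3"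
proof -
  have ne: "SG_a n \<noteq> SG_b n" "SG_a n \<noteq> (0, 0)" "SG_b n \<noteq> (0, 0)" by (simp_all add: SG_a_def SG_b_def)
  note deg = degree_glue_edges[OF T] and V = SG_outmost_verts[of n]
  show "x \<in> SG_verts n \<Longrightarrow> x \<noteq> SG_a n \<Longrightarrow> x \<noteq> SG_b n \<Longrightarrow>
      degree x (glue_edges n T1 T2 T3) = degree x T1"
    unfolding deg using mem_shift_verts(1,2) by (simp add: card_shift_filter_0[OF T(2)] card_shift_filter_0[OF T(3)])
  have "card {e \<in> T2. SG_a n \<in> shift_a n ` e} = degree (0, 0) T2"
    unfolding shift_corners(1) by (rule card_shift_filter)
  moreover have "card {e \<in> T3. SG_a n \<in> shift_b n ` e} = 0"
    using mem_shift_verts(2)[OF V(2)] ne by (intro card_shift_filter_0[OF T(3)]) simp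
  ultimately show "degree (SG_a n) (glue_edges n T1 T2 T3) = degree (SG_a n) T1 + degree (0, 0) T2"
    unfolding deg by simp
  have "degree (SG_c n) T1 = 0"
    unfolding shift_corners(3) using shift_a_in_SG_verts[OF V(3)] ne by (intro degree_0[OF T(1)]) blast
  moreover have "card {e \<in> T2. SG_c n \<in> shift_a n ` e} = degree (SG_b n) T2"
    unfolding shift_corners(3) by (rule card_shift_filter)
  moreover have "card {e \<in> T3. SG_c n \<in> shift_b n ` e} = degree (SG_a n) T3"
    unfolding shift_corners(4) by (rule card_shift_filter)
  ultimately show "degree (SG_c n) (glue_edges n T1 T2 T3) = degree (SG_b n) T2 + degree (SG_a n) T3"
    unfolding deg by simp
  have "degree (SG_a (Suc n)) T1 = 0"
    unfolding shift_corners(5) using shift_a_in_SG_verts[OF V(2)] ne by (intro degree_0[OF T(1)]) blast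
  moreover have "card {e \<in> T2. SG_a (Suc n) \<in> shift_a n ` e} = degree (SG_a n) T2"
    unfolding shift_corners(5) by (rule card_shift_filter)
  moreover have "card {e \<in> T3. SG_a (Suc n) \<in> shift_b n ` e} = 0"
    unfolding shift_corners(5) using shift_a_eq_shift_b(1)[OF V(2)] ne by (intro card_shift_filter_0[OF T(3)]) blast
  ultimately show "degree (SG_a (Suc n)) (glue_edges n T1 T2 T3) = degree (SG_a n) T2"
    unfolding deg by simp
  have "degree (SG_b (Suc n)) T1 = 0"
    unfolding shift_corners(6) using shift_b_in_SG_verts[OF V(3)] ne by (intro degree_0[OF T(1)]) blast
  moreover have "card {e \<in> T2. SG_b (Suc n) \<in> shift_a n ` e} = 0"
    unfolding shift_corners(6) using shift_a_eq_shift_b(2)[OF _ V(3)] ne by (intro card_shift_filter_0[OF T(2)]) (metis imageE)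
  moreover have "card {e \<in> T3. SG_b (Suc n) \<in> shift_b n ` e} = degree (SG_b n) T3"
    unfolding shift_corners(6) by (rule card_shift_filter)
  ultimately show "degree (SG_b (Suc n)) (glue_edges n T1 T2 T3) = degree (SG_b n) T3"
    unfolding deg by simp
qed

section \<open>Means over forests\<close>

lemma forest_sum_0:
  "forest_sum 0 w Joined = w {edge_oa, edge_ob} + w {edge_oa, edge_ab} + w {edge_ob, edge_ab}"
  "forest_sum 0 w Join_oa = w {edge_oa}" "forest_sum 0 w Join_ob = w {edge_ob}"
  "forest_sum 0 w Join_ab = w {edge_ab}" "forest_sum 0 w Separate = w {}"
  unfolding forest_sum_def forests_0 by (simp_all add: doubleton_eq_iff)

definition forest_count :: "nat \<Rightarrow> corner_type \<Rightarrow> real" where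
  "forest_count n = forest_sum n (\<lambda>_. 1)"

lemma forest_count_Suc: "forest_count (Suc n) = glue_sums (forest_count n) (forest_count n) (forest_count n)"
  unfolding forest_count_def by (rule forest_sum_Suc) simp

text \<open>Under these proportions the five recursions yield 6, 10, 10, 10 and 50 times
  \<open>c^3 * \<rho>\<close>, \<open>c^3 * \<rho>^2\<close> (three times) and
  \<open>c^3 * \<rho>^3\<close>. The ratio 10/6 is the factor 5/3, and 50/6 = 3 * (5/3)^2 reproduces
  the coefficient 3.\<close>

lemma forest_count_proportions:
  "forest_count n Joined > 0 \<and>
   forest_count n Join_oa = forest_count n Joined * ((5 / 3) ^ n / 3) \<and>
   forest_count n Join_ob = forest_count n Joined * ((5 / 3) ^ n / 3) \<and>
   forest_count n Join_ab = forest_count n Joined * ((5 / 3) ^ n / 3) \<and>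
   forest_count n Separate = 3 * forest_count n Joined * ((5 / 3) ^ n / 3)\<^sup>2"
proof (induction n)
  case 0
  show ?case by (simp add: forest_count_def forest_sum_0 power2_eq_square)
next
  case (Suc n)
  define c where "c = forest_count n Joined"
  define \<rho> :: real where "\<rho> = (5 / 3) ^ n / 3"
  have pos: "c > 0" "\<rho> > 0" using Suc.IH by (simp_all add: c_def \<rho>_def)
  have eqs: "forest_count n Joined = c" "forest_count n Join_oa = c * \<rho>" "forest_count n Join_ob = c * \<rho>"
    "forest_count n Join_ab = c * \<rho>" "forest_count n Separate = 3 * c * \<rho>\<^sup>2"
    using Suc.IH by (simp_all add: c_def \<rho>_def)
  have next_rho: "(5 / 3) ^ Suc n / 3 = 5 / 3 * \<rho>" by (simp add: \<rho>_def)
  show ?case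
    unfolding forest_count_Suc glue_sums_Joined glue_sums_Join_oa glue_sums_Join_ob glue_sums_Join_ab
      glue_sums_Separate eqs next_rho
    using pos by (simp add: algebra_simps power2_eq_square)
qed

lemma forest_count_pos: "forest_count n t > 0"
proof -
  define \<rho> :: real where "\<rho> = (5 / 3) ^ n / 3"
  have "\<rho> > 0" by (simp add: \<rho>_def)
  then show ?thesis
    using forest_count_proportions[of n, folded \<rho>_def] by (cases t) simp_all
qed

definition forest_mean :: "nat \<Rightarrow> ((nat \<times> nat) set set \<Rightarrow> real) \<Rightarrow> corner_type \<Rightarrow> real" where
  "forest_mean n w t = forest_sum n w t / forest_count n t"

lemma forest_mean_one: "forest_mean n (\<lambda>_. 1) t = 1"
  using forest_count_pos[of n t] by (simp add: forest_mean_def forest_count_def)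

lemma forest_mean_0:
  "forest_mean 0 w Joined = (w {edge_oa, edge_ob} + w {edge_oa, edge_ab} + w {edge_ob, edge_ab}) / 3"
  "forest_mean 0 w Join_oa = w {edge_oa}" "forest_mean 0 w Join_ob = w {edge_ob}"
  "forest_mean 0 w Join_ab = w {edge_ab}" "forest_mean 0 w Separate = w {}"
  by (simp_all add: forest_mean_def forest_count_def forest_sum_0)

text \<open>The powers of \<open>c\<close> and \<open>\<rho>\<close> cancel against the counts of
  the next level. Each factor of type \<open>Separate\<close> keeps a 3 from its count
  \<open>3 * c * \<rho>^2\<close>, and the denominators 6, 10, 50 are the sums of the coefficients,
  so that constant weight 1 has mean 1.\<close>

lemma forest_mean_Suc:
  fixes w w1 w2 w3 :: "(nat \<times> nat) set set \<Rightarrow> real"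
  assumes w: "\<forall>T1\<subseteq>SG_edges n. \<forall>T2\<subseteq>SG_edges n. \<forall>T3\<subseteq>SG_edges n.
      w (glue_edges n T1 T2 T3) = w1 T1 * w2 T2 * w3 T3"
    and F: "F = forest_mean n w1" and G: "G = forest_mean n w2" and H: "H = forest_mean n w3"
  shows "forest_mean (Suc n) w Joined = (F Joined * G Joined * (H Join_ob + H Join_ab)
     + F Joined * (G Join_oa + G Join_ab) * H Joined + (F Join_oa + F Join_ob) * G Joined * H Joined) / 6" (is ?J)
    and "forest_mean (Suc n) w Join_oa = (3 * F Joined * G Joined * H Separate
     + F Joined * G Join_oa * (H Join_oa + H Join_ab)
     + F Joined * G Join_ab * H Join_oa + F Join_oa * G Joined * (H Join_oa + H Join_ob)
     + F Join_oa * G Join_oa * H Joined + F Join_ob * G Joined * H Join_oa) / 10" (is ?oa)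
    and "forest_mean (Suc n) w Join_ob = (3 * F Joined * G Separate * H Joined
     + F Joined * G Join_ob * (H Join_ob + H Join_ab)
     + F Joined * G Join_ab * H Join_ob + F Join_oa * G Join_ob * H Joined
     + F Join_ob * (G Join_oa + G Join_ob) * H Joined + F Join_ob * G Joined * H Join_ob) / 10" (is ?ob)
    and "forest_mean (Suc n) w Join_ab = (F Joined * G Join_ab * H Join_ab + F Join_oa * G Join_ab * H Joined
     + F Join_ob * G Joined * H Join_ab + F Join_ab * G Joined * (H Join_ob + H Join_ab)
     + F Join_ab * (G Join_oa + G Join_ab) * H Joined + 3 * F Separate * G Joined * H Joined) / 10" (is ?ab)
    and "forest_mean (Suc n) w Separate =
     (3 * F Joined * (G Join_ob + G Join_ab) * H Separate + 3 * F Joined * G Separate * (H Join_oa + H Join_ab)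
     + F Join_oa * ((G Join_ob + G Join_ab) * (H Join_oa + H Join_ob) + 3 * G Separate * H Joined)
     + F Join_ob * (3 * G Joined * H Separate + (G Join_oa + G Join_ob) * (H Join_oa + H Join_ab))
     + F Join_ab * (3 * G Joined * H Separate + G Join_oa * (H Join_oa + H Join_ab)
         + G Join_ob * (H Join_ob + H Join_ab) + G Join_ab * (H Join_oa + H Join_ob) + 3 * G Separate * H Joined)
     + 3 * F Separate * (G Joined * (H Join_oa + H Join_ob) + (G Join_oa + G Join_ob) * H Joined)) / 50" (is ?s)
proof -
  define c where "c = forest_count n Joined"
  define \<rho> :: real where "\<rho> = (5 / 3) ^ n / 3"
  note props = forest_count_proportions[of n, folded c_def \<rho>_def]
  have pos: "c > 0" "\<rho> > 0" using props by (simp_all add: \<rho>_def)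
  have counts: "forest_count n Joined = c" "forest_count n Join_oa = c * \<rho>" "forest_count n Join_ob = c * \<rho>"
    "forest_count n Join_ab = c * \<rho>" "forest_count n Separate = 3 * c * \<rho>\<^sup>2"
    using props by (simp_all add: c_def)
  have sums: "forest_sum n v Joined = c * forest_mean n v Joined"
    "forest_sum n v Join_oa = c * \<rho> * forest_mean n v Join_oa"
    "forest_sum n v Join_ob = c * \<rho> * forest_mean n v Join_ob"
    "forest_sum n v Join_ab = c * \<rho> * forest_mean n v Join_ab"
    "forest_sum n v Separate = 3 * c * \<rho>\<^sup>2 * forest_mean n v Separate" for v
    using pos by (simp_all add: forest_mean_def counts)
  have Suc_counts: "forest_count (Suc n) Joined = c ^ 3 * \<rho> * 6"
    "forest_count (Suc n) Join_oa = c ^ 3 * \<rho>\<^sup>2 * 10" "forest_count (Suc n) Join_ob = c ^ 3 * \<rho>\<^sup>2 * 10"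
    "forest_count (Suc n) Join_ab = c ^ 3 * \<rho>\<^sup>2 * 10" "forest_count (Suc n) Separate = c ^ 3 * \<rho> ^ 3 * 50"
    unfolding forest_count_Suc glue_sums_Joined glue_sums_Join_oa glue_sums_Join_ob glue_sums_Join_ab
      glue_sums_Separate counts by (simp_all add: algebra_simps power2_eq_square power3_eq_cube)
  have cancel: "x / (k * y) = z / y" if "x = k * z" "k > 0" for x k y z :: real using that by simp
  have sums_Suc: "forest_sum (Suc n) w = glue_sums (forest_sum n w1) (forest_sum n w2) (forest_sum n w3)"
    using w by (intro forest_sum_Suc) blast
  show ?J unfolding forest_mean_def[of "Suc n"] Suc_counts
    by (rule cancel) (use pos in \<open>simp_all add: sums_Suc glue_sums_Joined sums F G H
      algebra_simps power2_eq_square power3_eq_cube\<close>)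
  show ?oa unfolding forest_mean_def[of "Suc n"] Suc_counts
    by (rule cancel) (use pos in \<open>simp_all add: sums_Suc glue_sums_Join_oa sums F G H
      algebra_simps power2_eq_square power3_eq_cube\<close>)
  show ?ob unfolding forest_mean_def[of "Suc n"] Suc_counts
    by (rule cancel) (use pos in \<open>simp_all add: sums_Suc glue_sums_Join_ob sums F G H
      algebra_simps power2_eq_square power3_eq_cube\<close>)
  show ?ab unfolding forest_mean_def[of "Suc n"] Suc_counts
    by (rule cancel) (use pos in \<open>simp_all add: sums_Suc glue_sums_Join_ab sums F G H
      algebra_simps power2_eq_square power3_eq_cube\<close>)
  show ?s unfolding forest_mean_def[of "Suc n"] Suc_counts
    by (rule cancel) (use pos in \<open>simp_all add: sums_Suc glue_sums_Separate sums F G H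
      algebra_simps power2_eq_square power3_eq_cube\<close>)
qed

text \<open>
  The mean of \<open>z\<close> to the degree of a given corner over the forests of \<open>SG(n)\<close> in which, respectively,
  all corners are joined, this corner is joined to exactly one other, only the two other corners
  are joined, and no corners are joined.
\<close>

definition corner_joined :: "nat \<Rightarrow> real \<Rightarrow> real" where
  "corner_joined n z = (11 * z + 3 * z\<^sup>2) / 14 + 5 / 42 * (1 / 15) ^ n * (z\<^sup>2 - z)"

definition corner_pair :: "nat \<Rightarrow> real \<Rightarrow> real" where
  "corner_pair n z = (11 * z + 3 * z\<^sup>2) / 14 + 3 / 14 * (1 / 15) ^ n * (z - z\<^sup>2)"

definition corner_alone :: "nat \<Rightarrow> real \<Rightarrow> real" where
  "corner_alone n z = (11 * z + 3 * z\<^sup>2) / 14 + 2 / 7 * (1 / 15) ^ n * (z\<^sup>2 - z)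
     + (3 / 5) ^ n * (33 / 28 - 6 / 7 * z - 9 / 28 * z\<^sup>2) - 5 / 28 * (1 / 25) ^ n * (1 - z)\<^sup>2"

definition corner_separate :: "nat \<Rightarrow> real \<Rightarrow> real" where
  "corner_separate n z = (11 * z + 3 * z\<^sup>2) / 14 + 3 / 14 * (1 / 15) ^ n * (z - z\<^sup>2)
     + (3 / 5) ^ n * (11 / 14 - 4 / 7 * z - 3 / 14 * z\<^sup>2) + 3 / 14 * (1 / 25) ^ n * (1 - z)\<^sup>2"

lemmas corner_defs = corner_joined_def corner_pair_def corner_alone_def corner_separate_def

text \<open>The first two means form a system of their own with eigenvalues 1 and 1/15. It preserves
  9 \<open>corner_joined\<close> + 5 \<open>corner_pair\<close>, whose initial value 11z + 3z^2
  divided by 14 is the limit. The last two have the eigenvalues 3/5 and 1/25 and are driven by the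
  first two.\<close>

lemma corner_Suc:
  "corner_joined (Suc n) z = (4 * corner_joined n z + 2 * corner_pair n z) / 6"
  "corner_pair (Suc n) z = (6 * corner_joined n z + 4 * corner_pair n z) / 10"
  "corner_alone (Suc n) z =
     (corner_joined n z + 2 * corner_pair n z + 4 * corner_alone n z + 3 * corner_separate n z) / 10"
  "corner_separate (Suc n) z =
     (12 * corner_joined n z + 14 * corner_pair n z + 12 * corner_alone n z + 12 * corner_separate n z) / 50"
  unfolding corner_defs power_Suc
  by (simp_all add: algebra_simps power2_eq_square add_divide_distrib diff_divide_distrib)

lemma degree_empty: "degree x {} = 0"
  by (simp add: degree_def)

lemma degree_insert:
  assumes "finite T" "e \<notin> T"
  shows "degree x (insert e T) = of_bool (x \<in> e) + degree x T"
proof -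
  have "{d \<in> insert e T. x \<in> d} = (if x \<in> e then insert e {d \<in> T. x \<in> d} else {d \<in> T. x \<in> d})" by auto
  then show ?thesis using assms by (simp add: degree_def)
qed

text \<open>Each corner lies in one copy only, so two of the three weights are 1 and the recursion
  is linear. Each corner has its own induction, which avoids proving that the gasket is symmetric;
  what changes is the pair type in which the corner is left alone.\<close>

lemma forest_mean_origin:
  fixes z :: real
  shows "forest_mean n (\<lambda>T. z ^ degree (0, 0) T) Joined = corner_joined n z \<and>
    forest_mean n (\<lambda>T. z ^ degree (0, 0) T) Join_oa = corner_pair n z \<and>
    forest_mean n (\<lambda>T. z ^ degree (0, 0) T) Join_ob = corner_pair n z \<and>
    forest_mean n (\<lambda>T. z ^ degree (0, 0) T) Join_ab = corner_alone n z \<and>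
    forest_mean n (\<lambda>T. z ^ degree (0, 0) T) Separate = corner_separate n z"
proof (induction n)
  case 0
  show ?case
    by (simp add: forest_mean_0 degree_insert degree_empty doubleton_eq_iff corner_defs field_simps power2_eq_square)
next
  case (Suc n)
  note IH = Suc.IH
  have w: "\<forall>T1\<subseteq>SG_edges n. \<forall>T2\<subseteq>SG_edges n. \<forall>T3\<subseteq>SG_edges n.
      z ^ degree (0, 0) (glue_edges n T1 T2 T3) = z ^ degree (0, 0) T1 * 1 * 1"
    using SG_outmost_verts(1) by (simp add: degree_glue(1) SG_a_def SG_b_def)
  show ?case
    unfolding forest_mean_Suc[where w = "\<lambda>T. z ^ degree (0, 0) T", OF w refl refl refl] forest_mean_one
    by (simp add: IH corner_Suc field_simps)
qed

lemma forest_mean_a: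
  fixes z :: real
  shows "forest_mean n (\<lambda>T. z ^ degree (SG_a n) T) Joined = corner_joined n z \<and>
    forest_mean n (\<lambda>T. z ^ degree (SG_a n) T) Join_oa = corner_pair n z \<and>
    forest_mean n (\<lambda>T. z ^ degree (SG_a n) T) Join_ob = corner_alone n z \<and>
    forest_mean n (\<lambda>T. z ^ degree (SG_a n) T) Join_ab = corner_pair n z \<and>
    forest_mean n (\<lambda>T. z ^ degree (SG_a n) T) Separate = corner_separate n z"
proof (induction n)
  case 0
  show ?case
    by (simp add: forest_mean_0 degree_insert degree_empty doubleton_eq_iff SG_a_def corner_defs
        field_simps power2_eq_square)
next
  case (Suc n)
  note IH = Suc.IH
  have w: "\<forall>T1\<subseteq>SG_edges n. \<forall>T2\<subseteq>SG_edges n. \<forall>T3\<subseteq>SG_edges n.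
      z ^ degree (SG_a (Suc n)) (glue_edges n T1 T2 T3) = 1 * z ^ degree (SG_a n) T2 * 1"
    by (simp add: degree_glue(4))
  show ?case
    unfolding forest_mean_Suc[where w = "\<lambda>T. z ^ degree (SG_a (Suc n)) T", OF w refl refl refl] forest_mean_one
    by (simp add: IH corner_Suc field_simps)
qed

lemma forest_mean_b:
  fixes z :: real
  shows "forest_mean n (\<lambda>T. z ^ degree (SG_b n) T) Joined = corner_joined n z \<and>
    forest_mean n (\<lambda>T. z ^ degree (SG_b n) T) Join_oa = corner_alone n z \<and>
    forest_mean n (\<lambda>T. z ^ degree (SG_b n) T) Join_ob = corner_pair n z \<and>
    forest_mean n (\<lambda>T. z ^ degree (SG_b n) T) Join_ab = corner_pair n z \<and>
    forest_mean n (\<lambda>T. z ^ degree (SG_b n) T) Separate = corner_separate n z"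
proof (induction n)
  case 0
  show ?case
    by (simp add: forest_mean_0 degree_insert degree_empty doubleton_eq_iff SG_b_def corner_defs
        field_simps power2_eq_square)
next
  case (Suc n)
  note IH = Suc.IH
  have w: "\<forall>T1\<subseteq>SG_edges n. \<forall>T2\<subseteq>SG_edges n. \<forall>T3\<subseteq>SG_edges n.
      z ^ degree (SG_b (Suc n)) (glue_edges n T1 T2 T3) = 1 * 1 * z ^ degree (SG_b n) T3"
    by (simp add: degree_glue(5))
  show ?case
    unfolding forest_mean_Suc[where w = "\<lambda>T. z ^ degree (SG_b (Suc n)) T", OF w refl refl refl] forest_mean_one
    by (simp add: IH corner_Suc field_simps)
qed

text \<open>
  Once \<open>x\<close> lies only in the lower-left copy, the means \<open>t\<close> (type \<open>Joined\<close>) and \<open>s\<close> (sum over \<open>Join_oa\<close>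
  and \<open>Join_ob\<close>) obey a linear recursion with the left eigenvectors \<open>18t + 5s\<close> and \<open>2t - s\<close>, for the
  eigenvalues \<open>1\<close> and \<open>1/15\<close>.
\<close>

lemma forest_mean_inner:
  fixes z :: real and w :: "(nat \<times> nat) set set \<Rightarrow> real"
  assumes x: "x \<in> SG_verts k" "x \<noteq> SG_a k" "x \<noteq> SG_b k"
    "\<And>n. k \<le> n \<Longrightarrow> x \<noteq> SG_a n" "\<And>n. k \<le> n \<Longrightarrow> x \<noteq> SG_b n"
  defines "\<mu> \<equiv> \<lambda>n. forest_mean n (\<lambda>T. z ^ degree x T)"
  defines "C \<equiv> (18 * \<mu> k Joined + 5 * (\<mu> k Join_oa + \<mu> k Join_ob)) / 28"
    and "D \<equiv> 2 * \<mu> k Joined - (\<mu> k Join_oa + \<mu> k Join_ob)"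
  shows "\<mu> (k + m) Joined = C + 5 / 28 * (1 / 15) ^ m * D \<and>
    \<mu> (k + m) Join_oa + \<mu> (k + m) Join_ob = 2 * C - 9 / 14 * (1 / 15) ^ m * D"
proof (induction m)
  case 0
  show ?case by (simp add: C_def D_def field_simps)
next
  case (Suc m)
  have mem: "x \<in> SG_verts (k + m)" using x(1) SG_verts_mono[of k "k + m"] by auto
  \<comment> \<open>From level \<open>k\<close> on, \<open>x\<close> is never a common corner, so
    the other two copies have weight 1.\<close>
  have w: "\<forall>T1\<subseteq>SG_edges (k + m). \<forall>T2\<subseteq>SG_edges (k + m). \<forall>T3\<subseteq>SG_edges (k + m).
      z ^ degree x (glue_edges (k + m) T1 T2 T3) = z ^ degree x T1 * 1 * 1"
    using degree_glue(1)[OF _ _ _ mem] x(4)[of "k + m"] x(5)[of "k + m"] by simp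
  note rec = forest_mean_Suc[where w = "\<lambda>T. z ^ degree x T", OF w refl refl refl, unfolded forest_mean_one]
  let ?t = "\<mu> (k + m) Joined" and ?s = "\<mu> (k + m) Join_oa + \<mu> (k + m) Join_ob"
  \<comment> \<open>With weight 1 in the other copies, the means for \<open>Join_ab\<close> and
    \<open>Separate\<close> do not enter, and those for \<open>Join_oa\<close> and
    \<open>Join_ob\<close> enter through their sum.\<close>
  have "\<mu> (Suc (k + m)) Joined = (4 * ?t + ?s) / 6"
    unfolding \<mu>_def rec(1) by (simp add: field_simps)
  moreover have "\<mu> (Suc (k + m)) Join_oa + \<mu> (Suc (k + m)) Join_ob = (12 * ?t + 4 * ?s) / 10"
    unfolding \<mu>_def rec(2,3) by (simp add: field_simps)
  moreover have "?t = C + 5 / 28 * (1 / 15) ^ m * D" "?s = 2 * C - 9 / 14 * (1 / 15) ^ m * D"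
    using Suc.IH by blast+
  ultimately show ?case
    by (simp only: add_Suc_right power_Suc) (simp add: algebra_simps add_divide_distrib diff_divide_distrib)
qed

section \<open>Spanning trees\<close>

text \<open>Having only the two trivial closed sets amounts to being rooted with constant colours at
  the corners; the edge count is the same on both sides.\<close>

lemma spanning_trees_SG: "spanning_trees (SG_verts N) (SG_edges N) = forests N Joined"
proof -
  let ?V = "SG_verts N"
  have "is_tree ?V T \<longleftrightarrow> rooted N T \<and> corner_colours N T = admits Joined \<and> card T + blocks Joined = card ?V"
    if T: "T \<subseteq> SG_edges N" for T
  proof -
    have edges: "\<forall>e\<in>T. e \<subseteq> ?V \<and> card e = 2" using T SG_edges_subset by blast
    have V: "?V \<in> closed_sets ?V T" using edges by (auto simp: closed_sets_def)
    have "closed_sets ?V T = {{}, ?V} \<longleftrightarrow> rooted N T \<and> corner_colours N T = admits Joined"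
    proof
      assume c: "closed_sets ?V T = {{}, ?V}"
      then have "rooted N T" using SG_outmost_verts[of N] by (auto simp: rooted_def)
      moreover have "corner_colours N T = admits Joined"
        using SG_outmost_verts[of N] by (auto simp: fun_eq_iff corner_colours_def c)
      ultimately show "rooted N T \<and> corner_colours N T = admits Joined" by blast
    next
      assume r: "rooted N T \<and> corner_colours N T = admits Joined"
      then have empty: "S = {}"
        if "S \<in> closed_sets ?V T" "(0, 0) \<notin> S" "SG_a N \<notin> S" "SG_b N \<notin> S" for S
        using that unfolding rooted_def by metis
      have "S = {} \<or> S = ?V" if S: "S \<in> closed_sets ?V T" for S
      proof -
        have "corner_colours N T ((0, 0) \<in> S) (SG_a N \<in> S) (SG_b N \<in> S)"
          using S unfolding corner_colours_def by blast
        then have same: "(0, 0) \<in> S \<longleftrightarrow> SG_a N \<in> S" "SG_a N \<in> S \<longleftrightarrow> SG_b N \<in> S" using r by simp_all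
        show ?thesis
        proof (cases "(0, 0) \<in> S")
          case True
          \<comment> \<open>A closed set that contains all corners is handled through its
            complement, which contains none.\<close>
          have "sym_diff ?V S \<in> closed_sets ?V T" by (rule sym_diff_in_closed_sets[OF V S])
          moreover have "(0, 0) \<notin> sym_diff ?V S" "SG_a N \<notin> sym_diff ?V S" "SG_b N \<notin> sym_diff ?V S"
            using True same SG_outmost_verts[of N] by blast+
          ultimately have "sym_diff ?V S = {}" by (rule empty)
          then show ?thesis using S closed_setsD by blast
        next
          case False
          then have "S = {}" using S same by (intro empty) simp_all
          then show ?thesis ..
        qed
      qed
      then show "closed_sets ?V T = {{}, ?V}" using V empty_in_closed_sets by blast
    qed
    moreover have "?V \<noteq> {}" using SG_outmost_verts(1) by blast
    ultimately show ?thesis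
      using is_tree_iff_closed_sets[OF finite_SG_verts _ edges] by simp
  qed
  then show ?thesis unfolding spanning_trees_def forests_def by blast
qed

text \<open>Grouping the trees by the degree of \<open>x\<close> shows that the mean is the
  generating polynomial of the \<open>SG_F j N x\<close>. The bound \<open>d\<close> is left free so
  that it can be enlarged when coefficients are compared.\<close>

lemma forest_mean_eq_sum_SG_F:
  assumes "card (SG_edges N) \<le> d"
  shows "forest_mean N (\<lambda>T. z ^ degree x T) Joined = (\<Sum>j\<le>d. SG_F j N x * z ^ j)"
proof -
  let ?S = "forests N Joined"
  have bound: "degree x ` ?S \<subseteq> {..d}"
  proof (rule image_subsetI)
    fix T assume "T \<in> ?S"
    then have "T \<subseteq> SG_edges N" by (simp add: forests_def)
    then have "{e \<in> T. x \<in> e} \<subseteq> SG_edges N" by blast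
    then have "degree x T \<le> card (SG_edges N)"
      unfolding degree_def by (rule card_mono[OF finite_SG_edges])
    then show "degree x T \<in> {..d}" using assms by simp
  qed
  have "forest_sum N (\<lambda>T. z ^ degree x T) Joined = (\<Sum>j\<le>d. \<Sum>T\<in>{T \<in> ?S. degree x T = j}. z ^ degree x T)"
    unfolding forest_sum_def by (rule sum.group[OF finite_forests _ bound, symmetric]) simp
  also have "\<dots> = (\<Sum>j\<le>d. real (SG_fj j N x) * z ^ j)"
    by (rule sum.cong) (simp_all add: SG_fj_def spanning_trees_SG degree_def)
  finally have s: "forest_sum N (\<lambda>T. z ^ degree x T) Joined = (\<Sum>j\<le>d. real (SG_fj j N x) * z ^ j)" .
  have c: "forest_count N Joined = real (SG_f N)"
    by (simp add: forest_count_def forest_sum_def SG_f_def spanning_trees_SG)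
  show ?thesis unfolding forest_mean_def s c by (simp add: SG_F_def sum_divide_distrib)
qed

lemma SG_F_coefficients:
  assumes "\<And>z. forest_mean N (\<lambda>T. z ^ degree x T) Joined = c1 * z + c2 * z ^ 2 + c3 * z ^ 3 + c4 * z ^ 4"
  shows "SG_F 1 N x = c1" "SG_F 2 N x = c2" "SG_F 3 N x = c3" "SG_F 4 N x = c4"
proof -
  \<comment> \<open>The summand 4 makes the range of exponents cover the right-hand polynomial for
    small \<open>N\<close> as well.\<close>
  define d where "d = card (SG_edges N) + 4"
  define c where "c = (\<lambda>_::nat. 0::real)(1 := c1, 2 := c2, 3 := c3, 4 := c4)"
  have "(\<Sum>j\<le>d. c j * z ^ j) = (\<Sum>j\<in>{1, 2, 3, 4}. c j * z ^ j)" for z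
    by (rule sum.mono_neutral_right) (auto simp: d_def c_def)
  then have "(\<Sum>j\<le>d. SG_F j N x * z ^ j) = (\<Sum>j\<le>d. c j * z ^ j)" for z
    using forest_mean_eq_sum_SG_F[of N d z x] assms[of z] by (simp add: d_def c_def)
  then have "\<forall>j\<le>d. SG_F j N x = c j" by (simp flip: polyfun_eq_coeffs)
  then show "SG_F 1 N x = c1" "SG_F 2 N x = c2" "SG_F 3 N x = c3" "SG_F 4 N x = c4"
    by (simp_all add: d_def c_def)
qed

section \<open>Closed forms at a_n and c_n\<close>

lemma power_products:
  "(1 / 25) ^ n = (3 / 5) ^ n * (1 / 15 :: real) ^ n"
  "(1 / 375) ^ n = (3 / 5) ^ n * (1 / 15 :: real) ^ n * (1 / 15) ^ n"
  "(1 / 225) ^ n = (1 / 15 :: real) ^ n * (1 / 15) ^ n"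
  by (simp_all flip: power_mult_distrib)

text \<open>In \<open>SG(n + 1)\<close>, a_n is the right corner of the lower-left copy and the left
  corner of the lower-right copy, so products of two corner polynomials arise;
  \<open>forest_mean_inner\<close> then adds the \<open>m\<close> further levels.\<close>

lemma forest_mean_SG_a:
  "forest_mean (n + m + 1) (\<lambda>T. z ^ degree (SG_a n) T) Joined =
      (1815 / 5488 * (3 / 5) ^ n - 99 / 1372 * (1 / 25) ^ n + 55 / 16464 * (1 / 375) ^ n
        + (1 / 15) ^ m * (- (121 / 5488) * (3 / 5) ^ n - 22 / 1029 * (1 / 25) ^ n + 185 / 49392 * (1 / 375) ^ n)) * z
      + (121 / 196 - 825 / 5488 * (3 / 5) ^ n + 171 / 1372 * (1 / 25) ^ n - 55 / 5488 * (1 / 375) ^ n - 121 / 1176 * (1 / 15) ^ n + 1 / 294 * (1 / 225) ^ n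
        + (1 / 15) ^ m * (55 / 5488 * (3 / 5) ^ n + 38 / 1029 * (1 / 25) ^ n - 185 / 16464 * (1 / 375) ^ n - 143 / 3528 * (1 / 15) ^ n + 11 / 2646 * (1 / 225) ^ n)) * z ^ 2
      + (33 / 98 - 855 / 5488 * (3 / 5) ^ n - 45 / 1372 * (1 / 25) ^ n + 55 / 5488 * (1 / 375) ^ n + 11 / 147 * (1 / 15) ^ n - 1 / 147 * (1 / 225) ^ n
        + (1 / 15) ^ m * (57 / 5488 * (3 / 5) ^ n - 10 / 1029 * (1 / 25) ^ n + 185 / 16464 * (1 / 375) ^ n + 13 / 441 * (1 / 15) ^ n - 11 / 1323 * (1 / 225) ^ n)) * z ^ 3
      + (9 / 196 - 135 / 5488 * (3 / 5) ^ n - 27 / 1372 * (1 / 25) ^ n - 55 / 16464 * (1 / 375) ^ n + 11 / 392 * (1 / 15) ^ n + 1 / 294 * (1 / 225) ^ n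
        + (1 / 15) ^ m * (9 / 5488 * (3 / 5) ^ n - 2 / 343 * (1 / 25) ^ n - 185 / 49392 * (1 / 375) ^ n + 13 / 1176 * (1 / 15) ^ n + 11 / 2646 * (1 / 225) ^ n)) * z ^ 4"
proof -
  define \<mu> where "\<mu> k = forest_mean k (\<lambda>T. z ^ degree (SG_a n) T)" for k
  have w: "\<forall>T1\<subseteq>SG_edges n. \<forall>T2\<subseteq>SG_edges n. \<forall>T3\<subseteq>SG_edges n.
      z ^ degree (SG_a n) (glue_edges n T1 T2 T3) = z ^ degree (SG_a n) T1 * z ^ degree (0, 0) T2 * 1"
    by (simp add: degree_glue(2) power_add)
  have "SG_a n \<in> SG_verts (Suc n)" using SG_outmost_verts(2)[of n] by simp
  then have main: "\<mu> (Suc n + m) Joined = (18 * \<mu> (Suc n) Joined + 5 * (\<mu> (Suc n) Join_oa + \<mu> (Suc n) Join_ob)) / 28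
      + 5 / 28 * (1 / 15) ^ m * (2 * \<mu> (Suc n) Joined - (\<mu> (Suc n) Join_oa + \<mu> (Suc n) Join_ob))"
    unfolding \<mu>_def by (intro forest_mean_inner[THEN conjunct1]) (auto simp: SG_a_def SG_b_def)
  have first: "\<mu> (Suc n) Joined = (corner_joined n z * corner_joined n z * 2
      + corner_joined n z * (corner_pair n z + corner_alone n z)
      + (corner_pair n z + corner_alone n z) * corner_joined n z) / 6"
    "\<mu> (Suc n) Join_oa = (3 * corner_joined n z * corner_joined n z + 2 * corner_joined n z * corner_pair n z
      + corner_joined n z * corner_alone n z + 2 * corner_pair n z * corner_joined n z
      + corner_pair n z * corner_pair n z + corner_alone n z * corner_joined n z) / 10"
    "\<mu> (Suc n) Join_ob = (3 * corner_joined n z * corner_separate n z + 2 * corner_joined n z * corner_pair n z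
      + corner_joined n z * corner_alone n z + corner_pair n z * corner_pair n z
      + 2 * corner_alone n z * corner_pair n z + corner_alone n z * corner_joined n z) / 10"
    unfolding \<mu>_def forest_mean_Suc(1-3)[where w = "\<lambda>T. z ^ degree (SG_a n) T", OF w refl refl refl]
      forest_mean_one
    by (simp_all add: forest_mean_origin forest_mean_a)
  \<comment> \<open>By \<open>power_products\<close> everything is a polynomial in these three
    quantities and \<open>z\<close>, and the claim becomes a polynomial identity.\<close>
  define A B M :: real where ABM: "A = (3 / 5) ^ n" "B = (1 / 15) ^ n" "M = (1 / 15) ^ m"
  have level: "n + m + 1 = Suc n + m" by simp
  show ?thesis
    unfolding level \<mu>_def[symmetric] main
    unfolding first corner_defs power_products ABM[symmetric]
    by (simp add: algebra_simps power2_eq_square power3_eq_cube power4_eq_xxxx add_divide_distrib diff_divide_distrib)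
qed

text \<open>Here the two factors come from the topmost corner of the lower-right copy and the
  rightmost corner of the top copy, while the lower-left copy has weight 1.\<close>

lemma forest_mean_SG_c:
  "forest_mean (n + m + 1) (\<lambda>T. z ^ degree (SG_c n) T) Joined =
      (1089 / 2744 * (3 / 5) ^ n - 22 / 343 * (1 / 25) ^ n + 5 / 8232 * (1 / 375) ^ n
        + (1 / 15) ^ m * (- (121 / 1372) * (3 / 5) ^ n - 121 / 4116 * (1 / 25) ^ n + 20 / 3087 * (1 / 375) ^ n)) * z
      + (121 / 196 - 495 / 2744 * (3 / 5) ^ n + 38 / 343 * (1 / 25) ^ n - 5 / 2744 * (1 / 375) ^ n - 55 / 588 * (1 / 15) ^ n
        + (1 / 15) ^ m * (55 / 1372 * (3 / 5) ^ n + 209 / 4116 * (1 / 25) ^ n - 20 / 1029 * (1 / 375) ^ n - 22 / 441 * (1 / 15) ^ n + 10 / 1323 * (1 / 225) ^ n)) * z ^ 2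
      + (33 / 98 - 513 / 2744 * (3 / 5) ^ n - 10 / 343 * (1 / 25) ^ n + 5 / 2744 * (1 / 375) ^ n + 10 / 147 * (1 / 15) ^ n
        + (1 / 15) ^ m * (57 / 1372 * (3 / 5) ^ n - 55 / 4116 * (1 / 25) ^ n + 20 / 1029 * (1 / 375) ^ n + 16 / 441 * (1 / 15) ^ n - 20 / 1323 * (1 / 225) ^ n)) * z ^ 3
      + (9 / 196 - 81 / 2744 * (3 / 5) ^ n - 6 / 343 * (1 / 25) ^ n - 5 / 8232 * (1 / 375) ^ n + 5 / 196 * (1 / 15) ^ n
        + (1 / 15) ^ m * (9 / 1372 * (3 / 5) ^ n - 11 / 1372 * (1 / 25) ^ n - 20 / 3087 * (1 / 375) ^ n + 2 / 147 * (1 / 15) ^ n + 10 / 1323 * (1 / 225) ^ n)) * z ^ 4"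
proof -
  define \<mu> where "\<mu> k = forest_mean k (\<lambda>T. z ^ degree (SG_c n) T)" for k
  have w: "\<forall>T1\<subseteq>SG_edges n. \<forall>T2\<subseteq>SG_edges n. \<forall>T3\<subseteq>SG_edges n.
      z ^ degree (SG_c n) (glue_edges n T1 T2 T3) = 1 * z ^ degree (SG_b n) T2 * z ^ degree (SG_a n) T3"
    by (simp add: degree_glue(3) power_add)
  have "SG_c n \<in> SG_verts (Suc n)" using SG_outmost_verts(3)[of n] by (simp add: shift_corners(3))
  then have main: "\<mu> (Suc n + m) Joined = (18 * \<mu> (Suc n) Joined + 5 * (\<mu> (Suc n) Join_oa + \<mu> (Suc n) Join_ob)) / 28
      + 5 / 28 * (1 / 15) ^ m * (2 * \<mu> (Suc n) Joined - (\<mu> (Suc n) Join_oa + \<mu> (Suc n) Join_ob))"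
    unfolding \<mu>_def by (intro forest_mean_inner[THEN conjunct1]) (auto simp: SG_a_def SG_b_def SG_c_def)
  have first: "\<mu> (Suc n) Joined = (corner_joined n z * (corner_alone n z + corner_pair n z)
      + (corner_alone n z + corner_pair n z) * corner_joined n z + 2 * corner_joined n z * corner_joined n z) / 6"
    "\<mu> (Suc n) Join_oa = (3 * corner_joined n z * corner_separate n z + 2 * corner_alone n z * corner_pair n z
      + corner_pair n z * corner_pair n z + corner_joined n z * (corner_pair n z + corner_alone n z)
      + corner_alone n z * corner_joined n z + corner_joined n z * corner_pair n z) / 10"
    "\<mu> (Suc n) Join_ob = (3 * corner_separate n z * corner_joined n z
      + corner_pair n z * (corner_alone n z + corner_pair n z) + corner_pair n z * corner_alone n z
      + corner_pair n z * corner_joined n z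
      + (corner_alone n z + corner_pair n z) * corner_joined n z + corner_joined n z * corner_alone n z) / 10"
    unfolding \<mu>_def forest_mean_Suc(1-3)[where w = "\<lambda>T. z ^ degree (SG_c n) T", OF w refl refl refl]
      forest_mean_one
    by (simp_all add: forest_mean_a forest_mean_b)
  define A B M :: real where ABM: "A = (3 / 5) ^ n" "B = (1 / 15) ^ n" "M = (1 / 15) ^ m"
  have level: "n + m + 1 = Suc n + m" by simp
  show ?thesis
    unfolding level \<mu>_def[symmetric] main
    unfolding first corner_defs power_products ABM[symmetric]
    by (simp add: algebra_simps power2_eq_square power3_eq_cube power4_eq_xxxx add_divide_distrib diff_divide_distrib)
qed

theorem mainTheorem4:
  fixes n m :: nat
  shows
    "  SG_F 1 (n + m + 1) (SG_a n) =
         1815 / 5488 * (3 / 5) ^ n - 99 / 1372 * (1 / 25) ^ n + 55 / 16464 * (1 / 375) ^ n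
         + (1 / 15) ^ m * (- (121 / 5488) * (3 / 5) ^ n - 22 / 1029 * (1 / 25) ^ n + 185 / 49392 * (1 / 375) ^ n)
     \<and> SG_F 2 (n + m + 1) (SG_a n) =
         121 / 196 - 825 / 5488 * (3 / 5) ^ n + 171 / 1372 * (1 / 25) ^ n - 55 / 5488 * (1 / 375) ^ n - 121 / 1176 * (1 / 15) ^ n + 1 / 294 * (1 / 225) ^ n
         + (1 / 15) ^ m * (55 / 5488 * (3 / 5) ^ n + 38 / 1029 * (1 / 25) ^ n - 185 / 16464 * (1 / 375) ^ n - 143 / 3528 * (1 / 15) ^ n + 11 / 2646 * (1 / 225) ^ n)
     \<and> SG_F 3 (n + m + 1) (SG_a n) =
         33 / 98 - 855 / 5488 * (3 / 5) ^ n - 45 / 1372 * (1 / 25) ^ n + 55 / 5488 * (1 / 375) ^ n + 11 / 147 * (1 / 15) ^ n - 1 / 147 * (1 / 225) ^ n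
         + (1 / 15) ^ m * (57 / 5488 * (3 / 5) ^ n - 10 / 1029 * (1 / 25) ^ n + 185 / 16464 * (1 / 375) ^ n + 13 / 441 * (1 / 15) ^ n - 11 / 1323 * (1 / 225) ^ n)
     \<and> SG_F 4 (n + m + 1) (SG_a n) =
         9 / 196 - 135 / 5488 * (3 / 5) ^ n - 27 / 1372 * (1 / 25) ^ n - 55 / 16464 * (1 / 375) ^ n + 11 / 392 * (1 / 15) ^ n + 1 / 294 * (1 / 225) ^ n
         + (1 / 15) ^ m * (9 / 5488 * (3 / 5) ^ n - 2 / 343 * (1 / 25) ^ n - 185 / 49392 * (1 / 375) ^ n + 13 / 1176 * (1 / 15) ^ n + 11 / 2646 * (1 / 225) ^ n)
     \<and> SG_F 1 (n + m + 1) (SG_c n) =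
         1089 / 2744 * (3 / 5) ^ n - 22 / 343 * (1 / 25) ^ n + 5 / 8232 * (1 / 375) ^ n
         + (1 / 15) ^ m * (- (121 / 1372) * (3 / 5) ^ n - 121 / 4116 * (1 / 25) ^ n + 20 / 3087 * (1 / 375) ^ n)
     \<and> SG_F 2 (n + m + 1) (SG_c n) =
         121 / 196 - 495 / 2744 * (3 / 5) ^ n + 38 / 343 * (1 / 25) ^ n - 5 / 2744 * (1 / 375) ^ n - 55 / 588 * (1 / 15) ^ n
         + (1 / 15) ^ m * (55 / 1372 * (3 / 5) ^ n + 209 / 4116 * (1 / 25) ^ n - 20 / 1029 * (1 / 375) ^ n - 22 / 441 * (1 / 15) ^ n + 10 / 1323 * (1 / 225) ^ n)
     \<and> SG_F 3 (n + m + 1) (SG_c n) =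
         33 / 98 - 513 / 2744 * (3 / 5) ^ n - 10 / 343 * (1 / 25) ^ n + 5 / 2744 * (1 / 375) ^ n + 10 / 147 * (1 / 15) ^ n
         + (1 / 15) ^ m * (57 / 1372 * (3 / 5) ^ n - 55 / 4116 * (1 / 25) ^ n + 20 / 1029 * (1 / 375) ^ n + 16 / 441 * (1 / 15) ^ n - 20 / 1323 * (1 / 225) ^ n)
     \<and> SG_F 4 (n + m + 1) (SG_c n) =
         9 / 196 - 81 / 2744 * (3 / 5) ^ n - 6 / 343 * (1 / 25) ^ n - 5 / 8232 * (1 / 375) ^ n + 5 / 196 * (1 / 15) ^ n
         + (1 / 15) ^ m * (9 / 1372 * (3 / 5) ^ n - 11 / 1372 * (1 / 25) ^ n - 20 / 3087 * (1 / 375) ^ n + 2 / 147 * (1 / 15) ^ n + 10 / 1323 * (1 / 225) ^ n)"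
  by (intro conjI SG_F_coefficients[OF forest_mean_SG_a] SG_F_coefficients[OF forest_mean_SG_c])

end
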